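(* Let $A$ be the path matrix of a (nonnegative weighted) planar network $D$ of order $n$ and let $\lambda\vdash n$. Then $\mathrm{Imm}_{\eta^\lambda}(A)$ is equal to each of $$\sum_{\pi\in\mathcal P(D)}\mathrm{wgt}(\pi)\cdot\#\{\text{row-closed, left row-strict }\pi\text{-tableaux of shape }\lambda\},$$ $$\sum_{\pi\in\mathcal P_e(D)}\mathrm{wgt}(\pi)\cdot\#\{\text{descent-free }P(\pi)\text{-tableaux of shape }\lambda\},$$ $$\sum_{\pi\in\mathcal P_e(D)}\mathrm{wgt}(\pi)\cdot\#\{\text{excedance-free }P(\pi)\text{-tableaux of shape }\lambda\}.$$
   Context: A (nonnegative weighted) planar network of order $n$ is a directed, planar, acyclic digraph $D=(V,E)$ which can be embedded in a disc so that $2n$ distinguished vertices, labeled clockwise as $s_1,\dots,s_n,t_n,\dots,t_1$, lie on the boundary of the disc, with a nonnegative real weight assigned to each edge; the sources $s_i$ have indegree $0$ and the sinks $t_i$ have outdegree $0$. The weight of a source-to-sink path is the product of the weights of its edges. The path matrix $A=(a_{i,j})_{i,j\in[n]}$ of $D$ has $a_{i,j}$ equal to the sum of weights of all paths from $s_i$ to $t_j$. A path family $\pi=(\pi_1,\dots,\pi_n)$ has type $w=w_1\cdots w_n\in\mathfrak S_n$ if $\pi_i$ is a path from $s_i$ to $t_{w_i}$ for all $i$; $\mathrm{wgt}(\pi)=\mathrm{wgt}(\pi_1)\cdots\mathrm{wgt}(\pi_n)$. $\mathcal P(D)$ is the set of path families in $D$ of all types $w\in\mathfrak S_n$, and $\mathcal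 P_e(D)$ the subset of those whose type is the identity. For $\pi\in\mathcal P_e(D)$, $P(\pi)$ is the poset on $\{\pi_1,\dots,\pi_n\}$ with $\pi_i<\pi_j$ if and only if $i<j$ and $\pi_i$, $\pi_j$ do not intersect (share no vertex); the element $\pi_i$ has label $i$. For a class function $\theta$ on $\mathfrak S_n$, $\mathrm{Imm}_\theta(A)=\sum_{w\in\mathfrak S_n}\theta(w)a_{1,w_1}\cdots a_{n,w_n}$. $\eta^\lambda$ is the character of $\mathfrak S_n$ induced from the trivial character of the Young subgroup $\mathfrak S_\lambda$. For $\pi\in\mathcal P(D)$, a $\pi$-tableau of shape $\lambda$ is a filling of a Young diagram of shape $\lambda$ (with $\lambda_i$ boxes in row $i$) with $\pi_1,\dots,\pi_n$, each used once. For a $\pi$-tableau $U$, $L(U)$ and $R(U)$ are the tableaux of integers obtained by replacing each path by its source index, respectively its sink index. $U$ is left row-strict if entries of $L(U)$ increase from left to right in each row, and row-closed if for each $i$ the $i$th row of $R(U)$ is a rearrangement of the $i$th row of $L(U)$. For a poset $P$ with labeled elements, a $P$-tableau of shape $\lambda\vdash|P|$ is a filling of a Young diagram of shape $\lambda$ with the elements of $P$, each used once; $U_{i,j}$ is the $j$th entry of row $i$. It is descent-free if there is no $(i,j)$ with $U_{i,j}>_PU_{i,j+1}$. Let $\overline U$ be obtained from $U$ by sorting each row by increasing label; $U$ is excedance-free if there is no $(i,j)$ with $U_{i,j}>_P\overline U_{i,j}$. *)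

theory Defs
  imports
    "HOL-Analysis.Analysis"
    "HOL-Algebra.Sym_Groups"
    "Graph_Theory.Digraph"
    "Graph_Theory.Arc_Walk"
begin

section \<open>Planar networks\<close>

text \<open>The \<open>2n\<close> distinguished vertices in the order \<open>s\<^sub>1, \<dots>, s\<^sub>n, t\<^sub>n, \<dots>, t\<^sub>1\<close>, indexed by \<open>1, \<dots>, 2n\<close>.\<close>

definition boundary_vertex :: "nat \<Rightarrow> (nat \<Rightarrow> 'a) \<Rightarrow> (nat \<Rightarrow> 'a) \<Rightarrow> nat \<Rightarrow> 'a" where
  "boundary_vertex n s t k = (if k \<le> n then s k else t (2 * n + 1 - k))"

text \<open>Vertices are placed by \<open>\<phi>\<close> and each arc \<open>e\<close> is drawn as the simple curve \<open>\<gamma> e\<close>; here \<open>Path_Connected.arc\<close>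
  is the topological notion (an injective path), not the arc of a digraph. Distinct curves may meet
  only in the image of a common end vertex. The strictly decreasing angles \<open>\<theta>\<close>, all within one full turn,
  say that the distinguished vertices occur clockwise; in particular these \<open>2n\<close> vertices are distinct.\<close>

definition disc_embedding ::
  "('a, 'b) pre_digraph \<Rightarrow> nat \<Rightarrow> (nat \<Rightarrow> 'a) \<Rightarrow> (nat \<Rightarrow> 'a) \<Rightarrow>
    ('a \<Rightarrow> complex) \<Rightarrow> ('b \<Rightarrow> real \<Rightarrow> complex) \<Rightarrow> bool" where
  "disc_embedding D n s t \<phi> \<gamma> \<longleftrightarrow>
     inj_on \<phi> (verts D) \<and> \<phi> ` verts D \<subseteq> cball 0 1 \<and>
     (\<forall>e\<in>arcs D. Path_Connected.arc (\<gamma> e) \<and> path_image (\<gamma> e) \<subseteq> cball 0 1 \<and>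
        pathstart (\<gamma> e) = \<phi> (tail D e) \<and> pathfinish (\<gamma> e) = \<phi> (head D e) \<and>
        path_image (\<gamma> e) \<inter> \<phi> ` verts D = {\<phi> (tail D e), \<phi> (head D e)}) \<and>
     (\<forall>e\<in>arcs D. \<forall>f\<in>arcs D. e \<noteq> f \<longrightarrow>
        path_image (\<gamma> e) \<inter> path_image (\<gamma> f)
          \<subseteq> \<phi> ` ({tail D e, head D e} \<inter> {tail D f, head D f})) \<and>
     (\<exists>\<theta> :: nat \<Rightarrow> real.
        (\<forall>k\<in>{1..2 * n}. \<phi> (boundary_vertex n s t k) = cis (\<theta> k)) \<and>
        (\<forall>k\<in>{1..2 * n}. \<forall>l\<in>{1..2 * n}. k < l \<longrightarrow> \<theta> l < \<theta> k \<and> \<theta> k - \<theta> l < 2 * pi))"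

text \<open>Parallel arcs are allowed.\<close>

locale planar_network = fin_digraph D
  for D :: "('a, 'b) pre_digraph" +
  fixes n :: nat and s t :: "nat \<Rightarrow> 'a" and wgt :: "'b \<Rightarrow> real"
  assumes acyclic: "\<not> (\<exists>c. pre_digraph.cycle D c)"
    and source_in_verts: "i \<in> {1..n} \<Longrightarrow> s i \<in> verts D"
    and sink_in_verts: "i \<in> {1..n} \<Longrightarrow> t i \<in> verts D"
    and source_in_degree: "i \<in> {1..n} \<Longrightarrow> in_degree D (s i) = 0"
    and sink_out_degree: "i \<in> {1..n} \<Longrightarrow> out_degree D (t i) = 0"
    and wgt_nonneg: "e \<in> arcs D \<Longrightarrow> 0 \<le> wgt e"
    and embeddable: "\<exists>\<phi> \<gamma>. disc_embedding D n s t \<phi> \<gamma>"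

definition path_wgt :: "('b \<Rightarrow> real) \<Rightarrow> 'b list \<Rightarrow> real" where
  "path_wgt wgt p = prod_list (map wgt p)"

definition path_matrix ::
  "('a, 'b) pre_digraph \<Rightarrow> (nat \<Rightarrow> 'a) \<Rightarrow> (nat \<Rightarrow> 'a) \<Rightarrow> ('b \<Rightarrow> real) \<Rightarrow> nat \<Rightarrow> nat \<Rightarrow> real" where
  "path_matrix D s t wgt i j = (\<Sum>p | pre_digraph.apath D (s i) p (t j). path_wgt wgt p)"


section \<open>Path families\<close>

text \<open>A family is a function on \<open>{1..n}\<close>, made extensional so that it is determined by its \<open>n\<close> paths.\<close>

definition has_type ::
  "('a, 'b) pre_digraph \<Rightarrow> nat \<Rightarrow> (nat \<Rightarrow> 'a) \<Rightarrow> (nat \<Rightarrow> 'a) \<Rightarrow> (nat \<Rightarrow> 'b list) \<Rightarrow> (nat \<Rightarrow> nat) \<Rightarrow> bool" where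
  "has_type D n s t \<pi> w \<longleftrightarrow> (\<forall>i\<in>{1..n}. pre_digraph.apath D (s i) (\<pi> i) (t (w i)))"

definition path_families ::
  "('a, 'b) pre_digraph \<Rightarrow> nat \<Rightarrow> (nat \<Rightarrow> 'a) \<Rightarrow> (nat \<Rightarrow> 'a) \<Rightarrow> (nat \<Rightarrow> 'b list) set" where
  "path_families D n s t =
     {\<pi> \<in> extensional {1..n}. \<exists>w. w permutes {1..n} \<and> has_type D n s t \<pi> w}"

definition path_families_id ::
  "('a, 'b) pre_digraph \<Rightarrow> nat \<Rightarrow> (nat \<Rightarrow> 'a) \<Rightarrow> (nat \<Rightarrow> 'a) \<Rightarrow> (nat \<Rightarrow> 'b list) set" where
  "path_families_id D n s t = {\<pi> \<in> path_families D n s t. has_type D n s t \<pi> id}"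

definition family_wgt :: "nat \<Rightarrow> ('b \<Rightarrow> real) \<Rightarrow> (nat \<Rightarrow> 'b list) \<Rightarrow> real" where
  "family_wgt n wgt \<pi> = (\<Prod>i\<in>{1..n}. path_wgt wgt (\<pi> i))"

definition paths_intersect ::
  "('a, 'b) pre_digraph \<Rightarrow> (nat \<Rightarrow> 'a) \<Rightarrow> (nat \<Rightarrow> 'b list) \<Rightarrow> nat \<Rightarrow> nat \<Rightarrow> bool" where
  "paths_intersect D s \<pi> i j \<longleftrightarrow>
     set (pre_digraph.awalk_verts D (s i) (\<pi> i)) \<inter> set (pre_digraph.awalk_verts D (s j) (\<pi> j)) \<noteq> {}"

text \<open>The strict order of the poset \<open>P(\<pi>)\<close> on the set \<open>\<pi> ` {1..n}\<close>, and its labelling \<open>\<pi>\<^sub>i \<mapsto> i\<close>.\<close>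

definition family_less ::
  "('a, 'b) pre_digraph \<Rightarrow> nat \<Rightarrow> (nat \<Rightarrow> 'a) \<Rightarrow> (nat \<Rightarrow> 'b list) \<Rightarrow> 'b list \<Rightarrow> 'b list \<Rightarrow> bool" where
  "family_less D n s \<pi> p q \<longleftrightarrow>
     (\<exists>i\<in>{1..n}. \<exists>j\<in>{1..n}. p = \<pi> i \<and> q = \<pi> j \<and> i < j \<and> \<not> paths_intersect D s \<pi> i j)"

definition family_label :: "nat \<Rightarrow> (nat \<Rightarrow> 'b list) \<Rightarrow> 'b list \<Rightarrow> nat" where
  "family_label n \<pi> = inv_into {1..n} \<pi>"


section \<open>Tableaux\<close>

definition is_partition :: "nat list \<Rightarrow> nat \<Rightarrow> bool" where
  "is_partition lam n \<longleftrightarrow> sorted_wrt (\<ge>) lam \<and> 0 \<notin> set lam \<and> sum_list lam = n"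

text \<open>A tableau is the list of its rows; \<open>tableaux lam X\<close> are the fillings of the diagram of shape \<open>lam\<close>
  in which each element of \<open>X\<close> occurs exactly once.\<close>

definition tableaux :: "nat list \<Rightarrow> 'e set \<Rightarrow> 'e list list set" where
  "tableaux lam X = {U. map length U = lam \<and> distinct (concat U) \<and> set (concat U) = X}"

text \<open>Nonempty paths are lists of arcs, so the source is the tail of the first arc and the sink is the head of the last.\<close>

definition source_index :: "('a, 'b) pre_digraph \<Rightarrow> nat \<Rightarrow> (nat \<Rightarrow> 'a) \<Rightarrow> 'b list \<Rightarrow> nat" where
  "source_index D n s p = (THE i. i \<in> {1..n} \<and> s i = tail D (hd p))"

definition sink_index :: "('a, 'b) pre_digraph \<Rightarrow> nat \<Rightarrow> (nat \<Rightarrow> 'a) \<Rightarrow> 'b list \<Rightarrow> nat" where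
  "sink_index D n t p = (THE j. j \<in> {1..n} \<and> t j = head D (last p))"

definition left_tableau :: "('a, 'b) pre_digraph \<Rightarrow> nat \<Rightarrow> (nat \<Rightarrow> 'a) \<Rightarrow> 'b list list list \<Rightarrow> nat list list" where
  "left_tableau D n s U = map (map (source_index D n s)) U"

definition right_tableau :: "('a, 'b) pre_digraph \<Rightarrow> nat \<Rightarrow> (nat \<Rightarrow> 'a) \<Rightarrow> 'b list list list \<Rightarrow> nat list list" where
  "right_tableau D n t U = map (map (sink_index D n t)) U"

definition left_row_strict :: "('a, 'b) pre_digraph \<Rightarrow> nat \<Rightarrow> (nat \<Rightarrow> 'a) \<Rightarrow> 'b list list list \<Rightarrow> bool" where
  "left_row_strict D n s U \<longleftrightarrow> (\<forall>r\<in>set (left_tableau D n s U). sorted_wrt (<) r)"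

definition row_closed ::
  "('a, 'b) pre_digraph \<Rightarrow> nat \<Rightarrow> (nat \<Rightarrow> 'a) \<Rightarrow> (nat \<Rightarrow> 'a) \<Rightarrow> 'b list list list \<Rightarrow> bool" where
  "row_closed D n s t U \<longleftrightarrow>
     (\<forall>i<length U. mset (right_tableau D n t U ! i) = mset (left_tableau D n s U ! i))"

text \<open>In the next definitions \<open>lt\<close> is the strict order of a poset and \<open>lab\<close> the labelling of its elements;
  rows and columns are counted from 0.\<close>

definition descent_free :: "('e \<Rightarrow> 'e \<Rightarrow> bool) \<Rightarrow> 'e list list \<Rightarrow> bool" where
  "descent_free lt U \<longleftrightarrow>
     \<not> (\<exists>i j. i < length U \<and> Suc j < length (U ! i) \<and> lt (U ! i ! Suc j) (U ! i ! j))"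

definition row_sorted :: "('e \<Rightarrow> nat) \<Rightarrow> 'e list list \<Rightarrow> 'e list list" where
  "row_sorted lab U = map (sort_key lab) U"

definition excedance_free :: "('e \<Rightarrow> 'e \<Rightarrow> bool) \<Rightarrow> ('e \<Rightarrow> nat) \<Rightarrow> 'e list list \<Rightarrow> bool" where
  "excedance_free lt lab U \<longleftrightarrow>
     \<not> (\<exists>i j. i < length U \<and> j < length (U ! i) \<and> lt (row_sorted lab U ! i ! j) (U ! i ! j))"


section \<open>Induced characters and immanants\<close>

text \<open>The induced class function, \<open>g \<mapsto> 1/|H| \<Sum>\<^sub>x f\<degree>(x g x\<inverse>)\<close> with \<open>f\<degree>\<close> the extension of \<open>f\<close> by 0 outside \<open>H\<close>.\<close>

definition induced_class_function ::
  "('g, 'm) monoid_scheme \<Rightarrow> 'g set \<Rightarrow> ('g \<Rightarrow> real) \<Rightarrow> 'g \<Rightarrow> real" where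
  "induced_class_function G H f g =
     (\<Sum>x\<in>carrier G.
        (let y = x \<otimes>\<^bsub>G\<^esub> g \<otimes>\<^bsub>G\<^esub> (inv\<^bsub>G\<^esub> x) in if y \<in> H then f y else 0)) / real (card H)"

text \<open>The \<open>k\<close>-th block (from 0) of the partition of \<open>{1..sum_list lam}\<close> into consecutive intervals of sizes \<open>lam ! k\<close>.\<close>

definition young_block :: "nat list \<Rightarrow> nat \<Rightarrow> nat set" where
  "young_block lam k = {sum_list (take k lam) <.. sum_list (take (Suc k) lam)}"

definition young_subgroup :: "nat list \<Rightarrow> (nat \<Rightarrow> nat) set" where
  "young_subgroup lam =
     {w \<in> carrier (sym_group (sum_list lam)). \<forall>k<length lam. w ` young_block lam k = young_block lam k}"

definition eta_char :: "nat list \<Rightarrow> (nat \<Rightarrow> nat) \<Rightarrow> real" where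
  "eta_char lam = induced_class_function (sym_group (sum_list lam)) (young_subgroup lam) (\<lambda>_. 1)"

definition immanant :: "nat \<Rightarrow> ((nat \<Rightarrow> nat) \<Rightarrow> real) \<Rightarrow> (nat \<Rightarrow> nat \<Rightarrow> real) \<Rightarrow> real" where
  "immanant n \<theta> A = (\<Sum>w\<in>carrier (sym_group n). \<theta> w * (\<Prod>i\<in>{1..n}. A i (w i)))"

end

theory Submission
  imports Defs
begin

text \<open>
  Write \<open>A[I]\<close> for the submatrix of \<open>A\<close> with rows and columns in \<open>I\<close>. Since \<open>\<eta>\<^sup>\<lambda>(w)\<close> counts the
  ordered set partitions \<open>(I\<^sub>1, I\<^sub>2, \<dots>)\<close> of type \<open>\<lambda>\<close> whose blocks are all fixed by \<open>w\<close>, the immanant is the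
  sum over these partitions of \<open>perm A[I\<^sub>1] * perm A[I\<^sub>2] * \<dots>\<close>. Expanding the permanents gives the first
  formula, and it remains to show that \<open>perm A[I]\<close> is the generating function of the descent-free
  orderings of the identity-type families on \<open>I\<close>.

  By Muir's identity, \<open>\<Sum>B\<subseteq>I. (-1)\<^sup>|\<^sup>B\<^sup>| det A[B] perm A[I - B] = 0\<close> for nonempty \<open>I\<close>, which determines the
  permanents from the determinants. By the lemma of Lindstrom, Gessel and Viennot, \<open>det A[B]\<close>
  is the generating function of the families whose members are pairwise disjoint, that is, of those
  for which \<open>B\<close> is a chain. For a fixed poset, the numbers of descent-free words satisfy the same
  recursion, with \<open>det A[B]\<close> replaced by the indicator of chains, by a sign-reversing involution.

  Excedance-free words are counted by the permanent of the matrix \<open>M\<close> with entries \<open>[\<not> i <\<^sub>P j]\<close>, and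
  \<open>det M[B]\<close> is again the indicator of chains, so Muir's identity yields the third formula.
\<close>

section \<open>Determinants and permanents of submatrices\<close>

text \<open>A permanent has no signs, so families of non-identity type cannot be cancelled in it
  directly; rerouting them into identity families would need a weight-preserving bijection that
  keeps track of descents. Determinants avoid this: their crossing families cancel, and what
  survives depends only on which index sets are chains. Families on disjoint index sets glue to a
  family on the union, so the signed recursion for the weighted sums splits into one recursion for
  each fixed identity family, and there it is pure poset combinatorics.

  All counts and characters here are products over rows, hence sums over ordered set partitions;
  \<open>block_sum\<close> reduces each identity to a statement about a single block.

  The embedding serves two purposes: it makes the sources and sinks distinct, and it yields
  \<open>crossing\<close>, that paths with interlaced ends share a vertex. The latter is needed
  twice, for the transitivity of \<open>P(\<pi>)\<close> and for the fact that disjoint families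
  have identity type. Acyclicity makes walks simple and cuts at a vertex unique, which keeps tail
  swapping reversible.\<close>

definition perm_on :: "('a \<Rightarrow> 'a \<Rightarrow> real) \<Rightarrow> 'a set \<Rightarrow> real" where
  "perm_on A I = (\<Sum>w | w permutes I. \<Prod>i\<in>I. A i (w i))"

definition det_on :: "('a \<Rightarrow> 'a \<Rightarrow> real) \<Rightarrow> 'a set \<Rightarrow> real" where
  "det_on A I = (\<Sum>w | w permutes I. of_int (sign w) * (\<Prod>i\<in>I. A i (w i)))"

text \<open>For \<open>B\<close> invariant under \<open>w\<close> this is the restriction to
  \<open>B\<close>, extended by the identity so that \<open>sign\<close> applies to it and sees only
  the cycles inside \<open>B\<close>.\<close>

definition perm_restrict :: "'a set \<Rightarrow> ('a \<Rightarrow> 'a) \<Rightarrow> 'a \<Rightarrow> 'a" where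
  "perm_restrict B w x = (if x \<in> B then w x else x)"

lemma perm_on_empty [simp]: "perm_on A {} = 1"
  by (simp add: perm_on_def)

lemma det_on_empty [simp]: "det_on A {} = 1"
  by (simp add: det_on_def)

lemma perm_restrict_permutes:
  assumes "inj w" "w ` B = B"
  shows "perm_restrict B w permutes B"
proof (rule bij_imp_permutes)
  show "bij_betw (perm_restrict B w) B B"
    using assms by (auto simp: bij_betw_def perm_restrict_def inj_on_def image_def)
qed (simp add: perm_restrict_def)

lemma permutes_image_complement:
  assumes "w permutes X" "w ` B = B" "B \<subseteq> X"
  shows "w ` (X - B) = X - B"
  using assms by (metis image_set_diff permutes_image permutes_inj)

text \<open>The setwise stabiliser of \<open>B\<close> is the direct product of the symmetric groups
  on \<open>B\<close> and \<open>X - B\<close>; the two restrictions invert composition. The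
  factorisations in Muir's identity, in the expansion of the immanant and in the order of the Young
  subgroup all rest on this.\<close>

lemma sum_permutes_fixing:
  fixes F :: "('a \<Rightarrow> 'a) \<Rightarrow> real"
  assumes "finite X" "B \<subseteq> X"
  shows "(\<Sum>w | w permutes X \<and> w ` B = B. F w) =
    (\<Sum>u | u permutes B. \<Sum>v | v permutes X - B. F (u \<circ> v))"
proof -
  have "(\<Sum>w | w permutes X \<and> w ` B = B. F w) =
      (\<Sum>(u, v) \<in> {u. u permutes B} \<times> {v. v permutes X - B}. F (u \<circ> v))"
  proof (rule sum.reindex_bij_witness[where i = "\<lambda>(u, v). u \<circ> v"
        and j = "\<lambda>w. (perm_restrict B w, perm_restrict (X - B) w)"])
    fix w assume w: "w \<in> {w. w permutes X \<and> w ` B = B}"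
    then have w1: "w permutes X" "w ` B = B" and inj: "inj w"
      using permutes_inj by auto
    have c: "w ` (X - B) = X - B"
      using permutes_image_complement[OF w1 assms(2)] .
    have eq: "perm_restrict B w \<circ> perm_restrict (X - B) w = w"
    proof
      fix x
      consider "x \<in> B" | "x \<in> X - B" | "x \<notin> X" by blast
      then show "(perm_restrict B w \<circ> perm_restrict (X - B) w) x = w x"
      proof cases
        case 2
        then have "w x \<in> X - B" using c by blast
        with 2 show ?thesis by (auto simp: perm_restrict_def)
      qed (use assms permutes_not_in[OF w1(1)] in \<open>auto simp: perm_restrict_def\<close>)
    qed
    show "(case (perm_restrict B w, perm_restrict (X - B) w) of (u, v) \<Rightarrow> u \<circ> v) = w"
      using eq by simp
    show "(case (perm_restrict B w, perm_restrict (X - B) w) of (u, v) \<Rightarrow> F (u \<circ> v)) = F w"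
      using eq by simp
    show "(perm_restrict B w, perm_restrict (X - B) w) \<in> {u. u permutes B} \<times> {v. v permutes X - B}"
      using perm_restrict_permutes[OF inj] w1 c by auto
  next
    fix p assume "p \<in> {u. u permutes B} \<times> {v. v permutes X - B}"
    then obtain u v where p: "p = (u, v)" "u permutes B" "v permutes X - B" by auto
    have "u permutes X" "v permutes X"
      using p assms by (auto intro: permutes_subset)
    then have "u \<circ> v permutes X" by (rule permutes_compose[rotated])
    moreover have vB: "v x = x" if "x \<in> B" for x
      using that p by (auto simp: permutes_not_in)
    then have "(u \<circ> v) ` B = u ` B" by (simp add: image_comp[symmetric])
    ultimately show "(case p of (u, v) \<Rightarrow> u \<circ> v) \<in> {w. w permutes X \<and> w ` B = B}"
      using p by (simp add: permutes_image)
    have "perm_restrict B (u \<circ> v) = u"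
      using p vB by (auto simp: perm_restrict_def fun_eq_iff permutes_not_in)
    moreover have "perm_restrict (X - B) (u \<circ> v) = v"
    proof
      fix x show "perm_restrict (X - B) (u \<circ> v) x = v x"
      proof (cases "x \<in> X - B")
        case True
        then have "v x \<notin> B" using p(3) permutes_in_image by fastforce
        then show ?thesis using True p by (simp add: perm_restrict_def permutes_not_in)
      next
        case False
        then show ?thesis using p by (auto simp: perm_restrict_def permutes_not_in)
      qed
    qed
    ultimately show "(perm_restrict B (case p of (u, v) \<Rightarrow> u \<circ> v),
        perm_restrict (X - B) (case p of (u, v) \<Rightarrow> u \<circ> v)) = p"
      using p by simp
  qed
  also have "\<dots> = (\<Sum>u | u permutes B. \<Sum>v | v permutes X - B. F (u \<circ> v))"
    by (simp add: sum.cartesian_product)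
  finally show ?thesis .
qed

lemma perm_restrict_compose:
  assumes "u permutes B" "v permutes X - B"
  shows "perm_restrict B (u \<circ> v) = u"
  using assms by (auto simp: perm_restrict_def fun_eq_iff permutes_not_in)

lemma prod_compose_permutes:
  assumes "finite X" "B \<subseteq> X" "u permutes B" "v permutes X - B"
  shows "(\<Prod>i\<in>X. A i ((u \<circ> v) i)) = (\<Prod>i\<in>B. A i (u i)) * (\<Prod>i\<in>X - B. A i (v i) :: real)"
proof -
  have "(\<Prod>i\<in>X. A i ((u \<circ> v) i)) = (\<Prod>i\<in>X - B. A i ((u \<circ> v) i)) * (\<Prod>i\<in>B. A i ((u \<circ> v) i))"
    using assms by (intro prod.subset_diff) auto
  moreover have "(u \<circ> v) i = v i" if "i \<in> X - B" for i
  proof -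
    have "v i \<in> X - B" using permutes_in_image[OF assms(4)] that by blast
    then show ?thesis using assms(3) by (auto simp: permutes_not_in)
  qed
  moreover have "(u \<circ> v) i = u i" if "i \<in> B" for i
    using that assms by (auto simp: permutes_not_in)
  ultimately show ?thesis by simp
qed

text \<open>Induction on the set: bypassing a moved point \<open>a\<close> in its cycle changes neither the invariant
  subsets, up to \<open>a\<close>, nor their signs; a fixed point cancels in pairs.\<close>

lemma invariant_sign_sum:
  fixes w :: "'a \<Rightarrow> 'a"
  assumes "finite I" "I \<noteq> {}" "w permutes I"
  shows "(\<Sum>B | B \<subseteq> I \<and> w ` B = B. (-1) ^ card B * sign (perm_restrict B w)) = 0"
  using assms
proof (induction "card I" arbitrary: I w rule: less_induct)
  case less
  obtain a where a: "a \<in> I" using less.prems by auto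
  have inj: "inj w" using less.prems permutes_inj by auto
  have fin: "finite B" if "B \<subseteq> I" for B using that less.prems(1) finite_subset by auto
  define g where "g B = (-1) ^ card B * sign (perm_restrict B w)" for B
  show ?case
  proof (cases "w a = a")
    case True
    let ?T = "\<lambda>B. if a \<in> B then B - {a} else insert a B"
    have eq: "perm_restrict (insert a B) w = perm_restrict B w" for B
      using True by (auto simp: perm_restrict_def fun_eq_iff)
    have flip: "g (?T B) = - g B" if "B \<subseteq> I" for B
    proof (cases "a \<in> B")
      case True
      have cardB: "card B = Suc (card (B - {a}))" using card.remove[OF fin[OF that] True] .
      have restr: "perm_restrict B w = perm_restrict (B - {a}) w"
        using eq[of "B - {a}"] insert_Diff[OF True] by simp
      have "g B = - g (B - {a})" unfolding g_def cardB restr by simp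
      then show ?thesis using True by simp
    next
      case False
      then show ?thesis using fin[OF that] by (simp add: g_def eq)
    qed
    have inv: "w ` ?T B = ?T B" if "w ` B = B" for B
    proof (cases "a \<in> B")
      case True
      have "w ` (B - {a}) = w ` B - w ` {a}" using inj by (simp add: image_set_diff)
      then show ?thesis using True that \<open>w a = a\<close> by simp
    qed (use that True in auto)
    have "sum g {B. B \<subseteq> I \<and> w ` B = B} = (\<Sum>B | B \<subseteq> I \<and> w ` B = B. g (?T B))"
      by (rule sum.reindex_bij_witness[where i = ?T and j = ?T]) (use a inv in \<open>auto simp: insert_absorb split: if_splits\<close>)
    also have "\<dots> = - sum g {B. B \<subseteq> I \<and> w ` B = B}"
      using flip by (simp add: sum_negf)
    finally show ?thesis by (simp add: g_def)
  next
    case False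
    define b where "b = w a"
    have b: "b \<in> I" "b \<noteq> a" using a False permutes_in_image[OF less.prems(3)] by (auto simp: b_def)
    \<comment> \<open>\<open>w'\<close> fixes \<open>a\<close> and sends the former preimage of
      \<open>a\<close> directly to \<open>b\<close>, so the cycle loses only
      \<open>a\<close>.\<close>
    define w' where "w' = Transposition.transpose a b \<circ> w"
    have w'I: "w' permutes I"
      unfolding w'_def using a b less.prems(3) by (intro permutes_compose permutes_swap_id) auto
    have w'a: "w' a = a" by (simp add: w'_def b_def)
    have w': "w' permutes I - {a}"
      using w'I w'a by (auto simp: permutes_def)
    have inj': "inj w'" using w' permutes_inj by auto
    have tr: "w = Transposition.transpose a b \<circ> w'" by (simp add: w'_def fun_eq_iff)
    have IH: "(\<Sum>B | B \<subseteq> I - {a} \<and> w' ` B = B. (-1) ^ card B * sign (perm_restrict B w')) = 0"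
      using less.prems b a by (intro less.hyps w') (auto simp: card_gt_0_iff intro: card_Diff1_less)
    \<comment> \<open>An invariant set contains \<open>a\<close> exactly when it contains
      \<open>w a\<close>, so \<open>a\<close> can be restored after its removal; this is
      \<open>?up\<close>.\<close>
    have ab: "a \<in> B \<longleftrightarrow> b \<in> B" if "w ` B = B" for B
      using that inj by (metis b_def image_eqI inj_image_mem_iff)
    let ?S = "{B. B \<subseteq> I \<and> w ` B = B}" and ?S' = "{B. B \<subseteq> I - {a} \<and> w' ` B = B}"
    let ?up = "\<lambda>B. if b \<in> B then insert a B else B"
    have tri: "Transposition.transpose a b ` B = B" if "a \<in> B \<longleftrightarrow> b \<in> B" for B
      using that by (rule transpose_image_eq)
    have "sum g ?S = (\<Sum>B | B \<subseteq> I - {a} \<and> w' ` B = B. (-1) ^ card B * sign (perm_restrict B w'))"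
    proof (rule sum.reindex_bij_witness[where i = ?up and j = "\<lambda>B. B - {a}"])
      fix B assume B: "B \<in> ?S"
      then have B1: "B \<subseteq> I" "w ` B = B" and abB: "a \<in> B \<longleftrightarrow> b \<in> B" using ab by auto
      show "?up (B - {a}) = B" using abB b by auto
      have w'B: "w' ` B = B" using B1 tri[OF abB] by (metis image_comp w'_def)
      have "w' ` (B - {a}) = w' ` B - w' ` {a}" using inj' by (simp add: image_set_diff)
      then have w'Ba: "w' ` (B - {a}) = B - {a}" using w'B w'a by simp
      then show "B - {a} \<in> ?S'" using B1 by auto
      show "(-1) ^ card (B - {a}) * sign (perm_restrict (B - {a}) w') = g B"
      proof (cases "a \<in> B")
        case True
        have p: "perm_restrict (B - {a}) w' permutes B - {a}"
          using perm_restrict_permutes[OF inj' w'Ba] .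
        have finB: "finite B" using fin B1 by auto
        \<comment> \<open>Removing \<open>a\<close> costs one element and one transposition, and the
          two sign changes cancel.\<close>
        have "perm_restrict B w = Transposition.transpose a b \<circ> perm_restrict (B - {a}) w'"
        proof
          fix x show "perm_restrict B w x = (Transposition.transpose a b \<circ> perm_restrict (B - {a}) w') x"
            using True abB fun_cong[OF tr, of x] b_def[symmetric]
            by (cases "x = a") (auto simp: perm_restrict_def Transposition.transpose_def[of a b x])
        qed
        moreover have "permutation (perm_restrict (B - {a}) w')"
          using p finB permutation_permutes by blast
        ultimately have s: "sign (perm_restrict B w) = - sign (perm_restrict (B - {a}) w')"
          using b by (simp add: sign_compose permutation_swap_id sign_swap_id)
        have cardB: "card B = Suc (card (B - {a}))" using card.remove[OF finB True] .
        show ?thesis unfolding g_def cardB s by simp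
      next
        case False
        then have Ba: "B - {a} = B" by simp
        have "perm_restrict B w' = perm_restrict B w"
        proof
          fix x show "perm_restrict B w' x = perm_restrict B w x"
          proof (cases "x \<in> B")
            case True
            then have "w x \<in> B" using B1 by blast
            then show ?thesis using True False abB
              by (metis comp_apply perm_restrict_def transpose_apply_other w'_def)
          qed (simp add: perm_restrict_def)
        qed
        then show ?thesis by (simp add: g_def Ba)
      qed
    next
      fix B assume B: "B \<in> ?S'"
      then have B1: "B \<subseteq> I - {a}" "w' ` B = B" by auto
      show "?up B - {a} = B" using B1 by auto
      have "w' ` ?up B = ?up B" using B1 w'a by auto
      moreover have "a \<in> ?up B \<longleftrightarrow> b \<in> ?up B" using B1 b by auto
      ultimately have "w ` ?up B = ?up B"
        using tri by (metis image_comp tr)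
      then show "?up B \<in> ?S" using B1 a by auto
    qed
    then show ?thesis using IH by (simp add: g_def)
  qed
qed

text \<open>A term of the determinant on \<open>B\<close> times a term of the permanent on
  \<open>I - B\<close> is the monomial of a permutation \<open>w\<close> of \<open>I\<close> that
  preserves \<open>B\<close>, with the sign of its restriction to \<open>B\<close>. After exchanging
  the sums, the coefficient of each monomial is the sum in
  \<open>invariant_sign_sum\<close>.\<close>

lemma muir_identity:
  fixes A :: "'a \<Rightarrow> 'a \<Rightarrow> real"
  assumes "finite I" "I \<noteq> {}"
  shows "(\<Sum>B\<in>Pow I. (-1) ^ card B * det_on A B * perm_on A (I - B)) = 0"
proof -
  define a where "a w = (\<Prod>i\<in>I. A i (w i))" for w
  have finp: "finite {w. w permutes I}" using assms finite_permutations by auto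
  have summand: "(-1) ^ card B * det_on A B * perm_on A (I - B) =
      (\<Sum>w | w permutes I \<and> w ` B = B. a w * of_int ((-1) ^ card B * sign (perm_restrict B w)))"
    if B: "B \<subseteq> I" for B
  proof -
    have "(\<Sum>w | w permutes I \<and> w ` B = B. a w * of_int ((-1) ^ card B * sign (perm_restrict B w)))
      = (\<Sum>u | u permutes B. \<Sum>v | v permutes I - B.
          a (u \<circ> v) * of_int ((-1) ^ card B * sign (perm_restrict B (u \<circ> v))))"
      using sum_permutes_fixing[OF assms(1) B] .
    also have "\<dots> = (\<Sum>u | u permutes B. \<Sum>v | v permutes I - B. (-1) ^ card B *
        (of_int (sign u) * (\<Prod>i\<in>B. A i (u i))) * (\<Prod>i\<in>I - B. A i (v i)))"
      using assms B
      by (intro sum.cong refl) (simp add: a_def prod_compose_permutes perm_restrict_compose del: o_apply)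
    also have "\<dots> = (-1) ^ card B * det_on A B * perm_on A (I - B)"
      unfolding det_on_def perm_on_def mult.assoc sum_product by (simp add: sum_distrib_left mult.assoc)
    finally show ?thesis by simp
  qed
  have "(\<Sum>B\<in>Pow I. (-1) ^ card B * det_on A B * perm_on A (I - B)) =
      (\<Sum>B\<in>Pow I. \<Sum>w | w permutes I \<and> w ` B = B. a w * of_int ((-1) ^ card B * sign (perm_restrict B w)))"
    using summand by (intro sum.cong) auto
  also have "\<dots> = (\<Sum>B\<in>Pow I. \<Sum>w | w permutes I. if w ` B = B
      then a w * of_int ((-1) ^ card B * sign (perm_restrict B w)) else 0)"
    using finp by (simp add: sum.inter_filter[symmetric])
  also have "\<dots> = (\<Sum>w | w permutes I. \<Sum>B\<in>Pow I. if w ` B = B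
      then a w * of_int ((-1) ^ card B * sign (perm_restrict B w)) else 0)"
    by (rule sum.swap)
  also have "\<dots> = (\<Sum>w | w permutes I. a w *
      of_int (\<Sum>B | B \<subseteq> I \<and> w ` B = B. (-1) ^ card B * sign (perm_restrict B w)))"
    using assms(1)
    by (intro sum.cong refl) (simp add: sum.inter_filter[symmetric] sum_distrib_left)
  also have "\<dots> = 0"
    using assms by (simp add: invariant_sign_sum)
  finally show ?thesis .
qed

text \<open>Since \<open>e {} = 1\<close>, the term \<open>B = {}\<close> is the value on
  \<open>I\<close> itself, so each relation expresses it through values on proper subsets.\<close>

lemma signed_convolution_unique:
  fixes e f g :: "'a set \<Rightarrow> real"
  assumes "finite X" "e {} = 1" "f {} = g {}"
    and "\<And>I. I \<subseteq> X \<Longrightarrow> I \<noteq> {} \<Longrightarrow> (\<Sum>B\<in>Pow I. (-1) ^ card B * e B * f (I - B)) = 0"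
    and "\<And>I. I \<subseteq> X \<Longrightarrow> I \<noteq> {} \<Longrightarrow> (\<Sum>B\<in>Pow I. (-1) ^ card B * e B * g (I - B)) = 0"
  shows "f X = g X"
  using assms(1,4,5)
proof (induction X rule: finite_psubset_induct)
  case (psubset X)
  show ?case
  proof (cases "X = {}")
    case False
    have fin: "finite (Pow X)" using psubset by simp
    have split: "(\<Sum>B\<in>Pow X. (-1) ^ card B * e B * h (X - B)) =
        h X + (\<Sum>B\<in>Pow X - {{}}. (-1) ^ card B * e B * h (X - B))" for h :: "'a set \<Rightarrow> real"
      using sum.remove[OF fin, of "{}" "\<lambda>B. (-1) ^ card B * e B * h (X - B)"] assms(2) by simp
    have "f (X - B) = g (X - B)" if "B \<in> Pow X - {{}}" for B
    proof (rule psubset.IH)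
      show "X - B \<subset> X" using that by auto
      show "(\<Sum>B\<in>Pow I. (-1) ^ card B * e B * f (I - B)) = 0" if "I \<subseteq> X - B" "I \<noteq> {}" for I
        using that by (intro psubset.prems) auto
      show "(\<Sum>B\<in>Pow I. (-1) ^ card B * e B * g (I - B)) = 0" if "I \<subseteq> X - B" "I \<noteq> {}" for I
        using that by (intro psubset.prems) auto
    qed
    then have "(\<Sum>B\<in>Pow X - {{}}. (-1) ^ card B * e B * f (X - B)) =
        (\<Sum>B\<in>Pow X - {{}}. (-1) ^ card B * e B * g (X - B))" by simp
    then show ?thesis
      using split[of f] split[of g] psubset.prems(1)[of X] psubset.prems(2)[of X] False by simp
  qed (use assms(3) in simp)
qed

section \<open>Sums over ordered set partitions and tableaux\<close>

text \<open>Recursive form of the sum, over ordered set partitions of \<open>X\<close> with block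
  sizes \<open>lam\<close>, of the product of \<open>f\<close> over the blocks. The base case
  rejects a choice of blocks that does not exhaust \<open>X\<close>.\<close>

primrec block_sum :: "nat list \<Rightarrow> ('a set \<Rightarrow> real) \<Rightarrow> 'a set \<Rightarrow> real" where
  "block_sum [] f X = of_bool (X = {})"
| "block_sum (m # ms) f X = (\<Sum>I | I \<subseteq> X \<and> card I = m. f I * block_sum ms f (X - I))"

lemma block_sum_cong:
  assumes "\<And>I. I \<subseteq> X \<Longrightarrow> f I = g I"
  shows "block_sum lam f X = block_sum lam g X"
  using assms
proof (induction lam arbitrary: X)
  case (Cons m ms)
  then have "block_sum ms f (X - I) = block_sum ms g (X - I)" if "I \<subseteq> X" for I
    using that by (intro Cons.IH) auto
  with Cons.prems show ?case by (auto intro!: sum.cong)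
qed simp

lemma block_sum_of_fact:
  assumes "finite X"
  shows "block_sum lam (\<lambda>I. fact (card I) * f I) X = prod_list (map fact lam) * block_sum lam f X"
  using assms
proof (induction lam arbitrary: X)
  case (Cons m ms)
  then show ?case
    by (auto simp: sum_distrib_left mult_ac intro!: sum.cong)
qed simp

text \<open>A permutation preserving every block is a product of permutations of the blocks, so its
  monomial splits accordingly. The induction peels off the first block.\<close>

lemma sum_block_sum_permutes:
  assumes "finite X"
  shows "(\<Sum>w | w permutes X. block_sum lam (\<lambda>I. of_bool (w ` I = I)) X * (\<Prod>i\<in>X. A i (w i))) =
    block_sum lam (perm_on A) X"
  using assms
proof (induction lam arbitrary: X)
  case Nil
  then show ?case by (cases "X = {}") simp_all
next
  case (Cons m ms)
  let ?f = "\<lambda>w I. of_bool (w ` I = I) :: real"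
  let ?Is = "{I. I \<subseteq> X \<and> card I = m}"
  have fin: "finite {w. w permutes X}" using Cons.prems finite_permutations by blast
  have step: "(\<Sum>w | w permutes X \<and> w ` I = I. block_sum ms (?f w) (X - I) * (\<Prod>i\<in>X. A i (w i))) =
      perm_on A I * block_sum ms (perm_on A) (X - I)" if I: "I \<subseteq> X" for I
  proof -
    \<comment> \<open>The remaining blocks lie in \<open>X - I\<close>, where \<open>u\<close> acts
      trivially, so only \<open>v\<close> is tested on them.\<close>
    have cong: "block_sum ms (?f (u \<circ> v)) (X - I) = block_sum ms (?f v) (X - I)"
      if uv: "u permutes I" "v permutes X - I" for u v
    proof (rule block_sum_cong)
      fix J assume J: "J \<subseteq> X - I"
      have "u (v x) = v x" if "x \<in> J" for x
        using J that permutes_in_image[OF uv(2), of x] permutes_not_in[OF uv(1)] by blast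
      then have "(u \<circ> v) ` J = v ` J" by auto
      then show "?f (u \<circ> v) J = ?f v J" by simp
    qed
    have "(\<Sum>w | w permutes X \<and> w ` I = I. block_sum ms (?f w) (X - I) * (\<Prod>i\<in>X. A i (w i))) =
      (\<Sum>u | u permutes I. \<Sum>v | v permutes X - I.
          block_sum ms (?f (u \<circ> v)) (X - I) * (\<Prod>i\<in>X. A i ((u \<circ> v) i)))"
      using sum_permutes_fixing[OF Cons.prems I] .
    also have "\<dots> = (\<Sum>u | u permutes I. \<Sum>v | v permutes X - I.
        (\<Prod>i\<in>I. A i (u i)) * (block_sum ms (?f v) (X - I) * (\<Prod>i\<in>X - I. A i (v i))))"
      using Cons.prems I
      by (intro sum.cong refl) (simp add: cong prod_compose_permutes del: o_apply)
    also have "\<dots> = perm_on A I * (\<Sum>v | v permutes X - I.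
        block_sum ms (?f v) (X - I) * (\<Prod>i\<in>X - I. A i (v i)))"
      by (simp add: perm_on_def sum_product)
    finally show ?thesis using Cons by simp
  qed
  have "(\<Sum>w | w permutes X. block_sum (m # ms) (?f w) X * (\<Prod>i\<in>X. A i (w i))) =
      (\<Sum>w | w permutes X. \<Sum>I\<in>?Is. if w ` I = I
          then block_sum ms (?f w) (X - I) * (\<Prod>i\<in>X. A i (w i)) else 0)"
    by (auto simp: sum_distrib_right intro!: sum.cong)
  also have "\<dots> = (\<Sum>I\<in>?Is. \<Sum>w | w permutes X. if w ` I = I
          then block_sum ms (?f w) (X - I) * (\<Prod>i\<in>X. A i (w i)) else 0)"
    by (rule sum.swap)
  also have "\<dots> = (\<Sum>I\<in>?Is. \<Sum>w | w permutes X \<and> w ` I = I.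
        block_sum ms (?f w) (X - I) * (\<Prod>i\<in>X. A i (w i)))"
    using fin by (intro sum.cong[OF refl, of ?Is]) (simp add: sum.inter_filter[symmetric])
  also have "\<dots> = block_sum (m # ms) (perm_on A) X"
    using step by (auto intro!: sum.cong)
  finally show ?case .
qed

lemma sum_PiE_split:
  fixes H :: "('a \<Rightarrow> 'b) \<Rightarrow> real"
  assumes "I \<subseteq> X"
  shows "(\<Sum>\<pi>\<in>PiE X F. H \<pi>) =
    (\<Sum>\<rho>\<in>PiE I F. \<Sum>\<sigma>\<in>PiE (X - I) F. H (\<lambda>i. if i \<in> I then \<rho> i else \<sigma> i))"
proof -
  have "(\<Sum>\<pi>\<in>PiE X F. H \<pi>) =
    (\<Sum>(\<rho>, \<sigma>)\<in>PiE I F \<times> PiE (X - I) F. H (\<lambda>i. if i \<in> I then \<rho> i else \<sigma> i))"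
    by (rule sum.reindex_bij_witness[where i = "\<lambda>(\<rho>, \<sigma>) i. if i \<in> I then \<rho> i else \<sigma> i"
          and j = "\<lambda>\<pi>. (restrict \<pi> I, restrict \<pi> (X - I))"])
      (use assms in \<open>auto simp: fun_eq_iff PiE_iff extensional_def restrict_def intro!: arg_cong[where f = H]\<close>)
  then show ?thesis by (simp add: sum.cartesian_product)
qed

lemma prod_if_split:
  assumes "finite X" "I \<subseteq> X"
  shows "(\<Prod>i\<in>X. c i (if i \<in> I then \<rho> i else \<sigma> i)) = (\<Prod>i\<in>I. c i (\<rho> i)) * (\<Prod>i\<in>X - I. c i (\<sigma> i) :: real)"
proof -
  have "(\<Prod>i\<in>X. c i (if i \<in> I then \<rho> i else \<sigma> i)) =
      (\<Prod>i\<in>X - I. c i (if i \<in> I then \<rho> i else \<sigma> i)) * (\<Prod>i\<in>I. c i (if i \<in> I then \<rho> i else \<sigma> i))"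
    using assms by (intro prod.subset_diff) auto
  then show ?thesis by simp
qed

text \<open>The hypothesis on \<open>g\<close> is locality: the value on a block depends only on the
  members indexed by it. A family is then an independent choice of subfamilies on the blocks, and
  products of generating functions of blocks become one sum over families on
  \<open>X\<close>.\<close>

lemma sum_PiE_block_sum:
  fixes c :: "'a \<Rightarrow> 'b \<Rightarrow> real"
  assumes "finite X"
    and g: "\<And>\<pi> \<pi>' I. (\<And>i. i \<in> I \<Longrightarrow> \<pi> i = \<pi>' i) \<Longrightarrow> g \<pi> I = g \<pi>' I"
  shows "(\<Sum>\<pi>\<in>PiE X F. (\<Prod>i\<in>X. c i (\<pi> i)) * block_sum lam (g \<pi>) X) =
    block_sum lam (\<lambda>I. \<Sum>\<pi>\<in>PiE I F. (\<Prod>i\<in>I. c i (\<pi> i)) * g \<pi> I) X"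
  using assms(1)
proof (induction lam arbitrary: X)
  case Nil
  then show ?case by (cases "X = {}") simp_all
next
  case (Cons m ms)
  let ?Is = "{I. I \<subseteq> X \<and> card I = m}"
  let ?h = "\<lambda>I. \<Sum>\<pi>\<in>PiE I F. (\<Prod>i\<in>I. c i (\<pi> i)) * g \<pi> I"
  have step: "(\<Sum>\<pi>\<in>PiE X F. (\<Prod>i\<in>X. c i (\<pi> i)) * (g \<pi> I * block_sum ms (g \<pi>) (X - I))) =
      ?h I * block_sum ms ?h (X - I)" if I: "I \<subseteq> X" for I
  proof -
    have 1: "g (\<lambda>i. if i \<in> I then \<rho> i else \<sigma> i) I = g \<rho> I" for \<rho> \<sigma>
      by (rule g) simp
    have 2: "block_sum ms (g (\<lambda>i. if i \<in> I then \<rho> i else \<sigma> i)) (X - I) = block_sum ms (g \<sigma>) (X - I)" for \<rho> \<sigma>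
      by (intro block_sum_cong g) auto
    have "(\<Sum>\<pi>\<in>PiE X F. (\<Prod>i\<in>X. c i (\<pi> i)) * (g \<pi> I * block_sum ms (g \<pi>) (X - I))) =
      (\<Sum>\<rho>\<in>PiE I F. \<Sum>\<sigma>\<in>PiE (X - I) F. ((\<Prod>i\<in>I. c i (\<rho> i)) * g \<rho> I) *
        ((\<Prod>i\<in>X - I. c i (\<sigma> i)) * block_sum ms (g \<sigma>) (X - I)))"
      unfolding sum_PiE_split[OF I] 1 2 prod_if_split[OF Cons.prems I]
      by (simp only: mult_ac)
    also have "\<dots> = ?h I * (\<Sum>\<sigma>\<in>PiE (X - I) F. (\<Prod>i\<in>X - I. c i (\<sigma> i)) * block_sum ms (g \<sigma>) (X - I))"
      by (simp only: sum_product)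
    finally show ?thesis using Cons by simp
  qed
  have "(\<Sum>\<pi>\<in>PiE X F. (\<Prod>i\<in>X. c i (\<pi> i)) * block_sum (m # ms) (g \<pi>) X) =
      (\<Sum>\<pi>\<in>PiE X F. \<Sum>I\<in>?Is. (\<Prod>i\<in>X. c i (\<pi> i)) * (g \<pi> I * block_sum ms (g \<pi>) (X - I)))"
    by (simp add: sum_distrib_left)
  also have "\<dots> = (\<Sum>I\<in>?Is. \<Sum>\<pi>\<in>PiE X F. (\<Prod>i\<in>X. c i (\<pi> i)) * (g \<pi> I * block_sum ms (g \<pi>) (X - I)))"
    by (rule sum.swap)
  also have "\<dots> = block_sum (m # ms) ?h X"
    using step by (auto intro!: sum.cong)
  finally show ?case .
qed

section \<open>Counting tableaux row by row\<close>

lemma finite_tableaux: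
  assumes "finite X"
  shows "finite (tableaux lam X)"
proof (rule finite_subset)
  show "tableaux lam X \<subseteq> {U. set U \<subseteq> {r. set r \<subseteq> X \<and> distinct r} \<and> length U = length lam}"
    by (auto simp: tableaux_def distinct_concat_iff dest: arg_cong[of _ _ length])
  show "finite {U. set U \<subseteq> {r. set r \<subseteq> X \<and> distinct r} \<and> length U = length lam}"
    using assms by (intro finite_lists_length_eq finite_subset_distinct)
qed

lemma tableaux_Cons:
  "r # V \<in> tableaux (m # ms) X \<longleftrightarrow>
    set r \<subseteq> X \<and> distinct r \<and> length r = m \<and> V \<in> tableaux ms (X - set r)"
proof -
  have "set r \<union> Y = X \<and> set r \<inter> Y = {} \<longleftrightarrow> set r \<subseteq> X \<and> Y = X - set r" for Y
    by blast
  then show ?thesis by (auto simp: tableaux_def simp del: set_concat)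
qed

lemma map_tableaux:
  assumes "V \<in> tableaux lam X" "inj_on g X"
  shows "map (map g) V \<in> tableaux lam (g ` X)"
  using assms by (auto simp: tableaux_def map_concat[symmetric] distinct_map o_def simp del: set_concat)

lemma map_map_tableaux_id:
  assumes "V \<in> tableaux lam X" "\<And>x. x \<in> X \<Longrightarrow> f x = x"
  shows "map (map f) V = V"
  using assms by (auto simp: tableaux_def intro!: map_idI)

text \<open>The condition concerns each row alone, so after the row sets are chosen the rows are
  filled independently. Every tableau count below becomes a \<open>block_sum\<close> in this
  way.\<close>

lemma card_tableaux_rows:
  assumes "finite X"
  shows "real (card {U \<in> tableaux lam X. \<forall>r\<in>set U. Q r}) =
    block_sum lam (\<lambda>I. real (card {r. distinct r \<and> set r = I \<and> Q r})) X"
  using assms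
proof (induction lam arbitrary: X)
  case Nil
  have "{U \<in> tableaux [] X. \<forall>r\<in>set U. Q r} = (if X = {} then {[]} else {})"
    by (auto simp: tableaux_def)
  then show ?case by simp
next
  case (Cons m ms)
  let ?R = "\<lambda>I. {r. distinct r \<and> set r = I \<and> Q r}"
  let ?T = "\<lambda>X. {U \<in> tableaux ms X. \<forall>r\<in>set U. Q r}"
  let ?Is = "{I. I \<subseteq> X \<and> card I = m}"
  have finI: "finite ?Is" using Cons.prems by simp
  have finR: "finite (?R I)" if "I \<subseteq> X" for I
    using finite_subset_distinct[OF Cons.prems] by (rule rev_finite_subset) (use that in auto)
  have finT: "finite (?T (X - I))" for I
    by (rule finite_subset[OF _ finite_tableaux[of "X - I" ms]]) (use Cons.prems in auto)
  have "bij_betw (\<lambda>(I, r, V). r # V) (SIGMA I:?Is. ?R I \<times> ?T (X - I))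
      {U \<in> tableaux (m # ms) X. \<forall>r\<in>set U. Q r}"
  proof (rule bij_betw_byWitness[where f' = "\<lambda>U. (set (hd U), hd U, tl U)"])
    show "(\<lambda>(I, r, V). r # V) ` (SIGMA I:?Is. ?R I \<times> ?T (X - I)) \<subseteq>
        {U \<in> tableaux (m # ms) X. \<forall>r\<in>set U. Q r}"
      by (auto simp: tableaux_Cons distinct_card)
    show "(\<lambda>U. (set (hd U), hd U, tl U)) ` {U \<in> tableaux (m # ms) X. \<forall>r\<in>set U. Q r} \<subseteq>
        (SIGMA I:?Is. ?R I \<times> ?T (X - I))"
    proof
      fix y assume "y \<in> (\<lambda>U. (set (hd U), hd U, tl U)) ` {U \<in> tableaux (m # ms) X. \<forall>r\<in>set U. Q r}"
      then obtain U where U: "U \<in> tableaux (m # ms) X" "\<forall>r\<in>set U. Q r" "y = (set (hd U), hd U, tl U)" by blast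
      then obtain r V where "U = r # V" by (cases U) (auto simp: tableaux_def)
      with U show "y \<in> (SIGMA I:?Is. ?R I \<times> ?T (X - I))"
        by (auto simp: tableaux_Cons distinct_card)
    qed
  qed (auto simp: tableaux_def)
  then have "card {U \<in> tableaux (m # ms) X. \<forall>r\<in>set U. Q r} = card (SIGMA I:?Is. ?R I \<times> ?T (X - I))"
    by (simp add: bij_betw_same_card)
  also have "\<dots> = (\<Sum>I\<in>?Is. card (?R I) * card (?T (X - I)))"
    using finI finR finT by (subst card_SigmaI) (auto simp: card_cartesian_product)
  finally show ?case using Cons by simp
qed

text \<open>With \<open>g\<close> a path family, tableaux of paths are counted through tableaux of
  their indices.\<close>

lemma card_tableaux_image:
  assumes "inj_on g X"
  shows "card {U \<in> tableaux lam (g ` X). P U} = card {V \<in> tableaux lam X. P (map (map g) V)}"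
proof -
  have "bij_betw (map (map g)) {V \<in> tableaux lam X. P (map (map g) V)} {U \<in> tableaux lam (g ` X). P U}"
  proof (rule bij_betw_byWitness[where f' = "map (map (inv_into X g))"])
    have inv: "map (map g) (map (map (inv_into X g)) U) = U" if "U \<in> tableaux lam (g ` X)" for U
      using map_map_tableaux_id[OF that, of "g \<circ> inv_into X g"] by (simp add: f_inv_into_f)
    have inv': "map (map (inv_into X g)) (map (map g) V) = V" if "V \<in> tableaux lam X" for V
      using map_map_tableaux_id[OF that, of "inv_into X g \<circ> g"] assms by simp
    show "\<forall>V\<in>{V \<in> tableaux lam X. P (map (map g) V)}. map (map (inv_into X g)) (map (map g) V) = V"
      using inv' by blast
    show "\<forall>U\<in>{U \<in> tableaux lam (g ` X). P U}. map (map g) (map (map (inv_into X g)) U) = U"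
      using inv by blast
    show "map (map g) ` {V \<in> tableaux lam X. P (map (map g) V)} \<subseteq> {U \<in> tableaux lam (g ` X). P U}"
      using map_tableaux[OF _ assms] by blast
    show "map (map (inv_into X g)) ` {U \<in> tableaux lam (g ` X). P U} \<subseteq> {V \<in> tableaux lam X. P (map (map g) V)}"
    proof
      fix y assume "y \<in> map (map (inv_into X g)) ` {U \<in> tableaux lam (g ` X). P U}"
      then obtain U where U: "U \<in> tableaux lam (g ` X)" "P U" "y = map (map (inv_into X g)) U" by blast
      have "y \<in> tableaux lam (inv_into X g ` g ` X)"
        unfolding U(3) by (intro map_tableaux U inj_on_inv_into) simp
      then have "y \<in> tableaux lam X" using assms by simp
      moreover have "map (map g) y = U" using inv[OF U(1)] U(3) by simp
      ultimately show "y \<in> {V \<in> tableaux lam X. P (map (map g) V)}" using U by simp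
    qed
  qed
  then show ?thesis by (simp add: bij_betw_same_card)
qed

text \<open>One-line notation relative to the enumeration \<open>xs\<close>.\<close>

lemma bij_betw_permutes_lists:
  assumes "distinct xs"
  shows "bij_betw (\<lambda>w. map w xs) {w. w permutes set xs} {r. distinct r \<and> set r = set xs}"
proof (rule bij_betw_imageI)
  show "inj_on (\<lambda>w. map w xs) {w. w permutes set xs}"
  proof (rule inj_onI)
    fix w w' assume "w \<in> {w. w permutes set xs}" "w' \<in> {w. w permutes set xs}" "map w xs = map w' xs"
    then show "w = w'" by (metis (no_types, lifting) ext map_eq_conv mem_Collect_eq permutes_not_in)
  qed
  show "(\<lambda>w. map w xs) ` {w. w permutes set xs} = {r. distinct r \<and> set r = set xs}"
  proof
    show "(\<lambda>w. map w xs) ` {w. w permutes set xs} \<subseteq> {r. distinct r \<and> set r = set xs}"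
      using assms by (auto simp: distinct_map permutes_inj_on permutes_image)
    show "{r. distinct r \<and> set r = set xs} \<subseteq> (\<lambda>w. map w xs) ` {w. w permutes set xs}"
    proof
      fix r assume "r \<in> {r. distinct r \<and> set r = set xs}"
      then have r: "distinct r" "set r = set xs" by auto
      then have len: "length r = length xs" using assms by (metis distinct_card)
      define m where "m = map_of (zip xs r)"
      define w where "w x = (case m x of Some y \<Rightarrow> y | None \<Rightarrow> x)" for x
      have wj: "w (xs ! j) = r ! j" if "j < length xs" for j
        using that len assms by (simp add: w_def m_def map_of_zip_nth)
      have map: "map w xs = r" using wj len by (auto intro!: nth_equalityI)
      have "w permutes set xs"
      proof (rule bij_imp_permutes)
        show "bij_betw w (set xs) (set xs)"
          using map r by (metis bij_betw_def distinct_map list.set_map)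
        show "w x = x" if "x \<notin> set xs" for x
          using that len by (simp add: w_def m_def map_of_zip_is_None split: option.split)
            (metis option.distinct(1) map_of_zip_is_None)
      qed
      then show "r \<in> (\<lambda>w. map w xs) ` {w. w permutes set xs}" using map by blast
    qed
  qed
qed

section \<open>Induced trivial characters\<close>

text \<open>Inverse of \<open>concat\<close> for a given shape. Cutting the word
  \<open>1, ..., n\<close> in this way gives the Young blocks as row sets, so the Young subgroup
  becomes the stabiliser of the rows of one tableau.\<close>

primrec chop_rows :: "nat list \<Rightarrow> 'a list \<Rightarrow> 'a list list" where
  "chop_rows [] xs = []"
| "chop_rows (m # ms) xs = take m xs # chop_rows ms (drop m xs)"

lemma length_chop_rows [simp]: "length (chop_rows lam xs) = length lam"
  by (induction lam arbitrary: xs) auto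

lemma concat_chop_rows: "length xs = sum_list lam \<Longrightarrow> concat (chop_rows lam xs) = xs"
  by (induction lam arbitrary: xs) auto

lemma map_length_chop_rows: "sum_list lam \<le> length xs \<Longrightarrow> map length (chop_rows lam xs) = lam"
  by (induction lam arbitrary: xs) auto

lemma chop_rows_concat: "chop_rows (map length U) (concat U) = U"
  by (induction U) auto

lemma chop_rows_nth:
  "k < length lam \<Longrightarrow> chop_rows lam xs ! k = take (lam ! k) (drop (sum_list (take k lam)) xs)"
  by (induction lam arbitrary: k xs) (auto simp: nth_Cons' take_Cons' add.commute gr0_conv_Suc)

lemma chop_rows_map: "chop_rows lam (map g xs) = map (map g) (chop_rows lam xs)"
  by (induction lam arbitrary: xs) (auto simp: take_map drop_map)

lemma bij_betw_chop_rows: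
  "bij_betw (chop_rows lam) {xs. distinct xs \<and> set xs = X \<and> length xs = sum_list lam} (tableaux lam X)"
proof (rule bij_betw_byWitness[where f' = concat])
  show "\<forall>xs\<in>{xs. distinct xs \<and> set xs = X \<and> length xs = sum_list lam}. concat (chop_rows lam xs) = xs"
    by (auto simp: concat_chop_rows)
  show "\<forall>U\<in>tableaux lam X. chop_rows lam (concat U) = U"
    by (auto simp: tableaux_def chop_rows_concat)
  show "chop_rows lam ` {xs. distinct xs \<and> set xs = X \<and> length xs = sum_list lam} \<subseteq> tableaux lam X"
    by (auto simp: tableaux_def concat_chop_rows map_length_chop_rows simp del: set_concat)
  show "concat ` tableaux lam X \<subseteq> {xs. distinct xs \<and> set xs = X \<and> length xs = sum_list lam}"
    by (auto simp: tableaux_def length_concat)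
qed

lemma take_drop_upt: "m + k \<le> n \<Longrightarrow> take m (drop k [Suc 0..<Suc n]) = [Suc k..<Suc (k + m)]"
  by (simp add: drop_upt take_upt del: upt_Suc)

lemma young_block_chop_rows:
  assumes "k < length lam"
  shows "set (chop_rows lam [1..<Suc (sum_list lam)] ! k) = young_block lam k"
proof -
  have "sum_list (take (Suc k) lam) + sum_list (drop (Suc k) lam) = sum_list lam"
    by (metis append_take_drop_id sum_list_append)
  moreover have *: "sum_list (take (Suc k) lam) = sum_list (take k lam) + lam ! k"
    using assms by (simp add: take_Suc_conv_app_nth)
  ultimately have "lam ! k + sum_list (take k lam) \<le> sum_list lam" by simp
  then show ?thesis
    using assms * by (auto simp: chop_rows_nth take_drop_upt young_block_def simp del: upt_Suc)
qed

text \<open>Gives the order of the Young subgroup: the stabiliser is the product of the symmetric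
  groups on the rows, split off one at a time.\<close>

lemma card_block_stabiliser:
  assumes "finite X" "V \<in> tableaux lam X"
  shows "real (card {w. w permutes X \<and> (\<forall>r\<in>set V. w ` set r = set r)}) = prod_list (map fact lam)"
  using assms
proof (induction lam arbitrary: X V)
  case Nil
  then have "V = []" "X = {}" by (auto simp: tableaux_def)
  then show ?case by simp
next
  case (Cons m ms)
  then obtain r V' where V: "V = r # V'" by (cases V) (auto simp: tableaux_def)
  let ?I = "set r"
  have r: "?I \<subseteq> X" "distinct r" "length r = m" "V' \<in> tableaux ms (X - ?I)"
    using Cons.prems V by (auto simp: tableaux_Cons)
  let ?P = "\<lambda>w. \<forall>r\<in>set V'. w ` set r = set r"
  have eq: "?P (u \<circ> v) = ?P v" if "u permutes ?I" "v permutes X - ?I" for u v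
  proof -
    have "(u \<circ> v) ` set q = v ` set q" if q: "q \<in> set V'" for q
    proof -
      have "set q \<subseteq> X - ?I" using r(4) q by (auto simp: tableaux_def)
      then have "u (v x) = v x" if "x \<in> set q" for x
        using that permutes_in_image[OF \<open>v permutes X - ?I\<close>, of x] permutes_not_in[OF \<open>u permutes ?I\<close>] by blast
      then show ?thesis by auto
    qed
    then show ?thesis by simp
  qed
  have fin: "finite {w. w permutes Y}" if "Y \<subseteq> X" for Y
    using that Cons.prems(1) finite_permutations finite_subset by blast
  have card_filter: "(\<Sum>w | w permutes Y. of_bool (?P w)) = real (card {w. w permutes Y \<and> ?P w})"
    if "Y \<subseteq> X" for Y
    using fin[OF that] by (simp add: sum.If_cases Int_def of_bool_def)
  have "real (card {w. w permutes X \<and> (\<forall>r\<in>set V. w ` set r = set r)}) =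
      (\<Sum>w | w permutes X \<and> w ` ?I = ?I. of_bool (?P w))"
  proof -
    have "finite {w. w permutes X \<and> w ` ?I = ?I}" using fin[of X] by simp
    then show ?thesis by (simp add: sum.If_cases Int_def of_bool_def V conj_assoc)
  qed
  also have "\<dots> = (\<Sum>u | u permutes ?I. \<Sum>v | v permutes X - ?I. of_bool (?P v))"
    unfolding sum_permutes_fixing[OF Cons.prems(1) r(1)]
    by (intro sum.cong refl) (simp add: eq del: o_apply)
  also have "\<dots> = fact m * prod_list (map fact ms)"
    using Cons.IH[OF _ r(4)] Cons.prems(1) r
    by (simp add: card_filter card_permutations[OF refl] distinct_card)
  finally show ?case by simp
qed

lemma card_distinct_lists:
  assumes "finite I"
  shows "card {r. distinct r \<and> set r = I} = fact (card I)"
proof -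
  obtain xs where xs: "distinct xs" "set xs = I" using assms finite_distinct_list by blast
  then show ?thesis
    using bij_betw_same_card[OF bij_betw_permutes_lists[OF xs(1)]] card_permutations[OF refl, of I] assms
    by simp
qed

lemma young_subgroup_iff:
  assumes "lam_n = sum_list lam" "V = chop_rows lam [1..<Suc lam_n]"
  shows "w \<in> young_subgroup lam \<longleftrightarrow> w permutes {1..lam_n} \<and> (\<forall>r\<in>set V. w ` set r = set r)"
proof -
  have "(\<forall>r\<in>set V. w ` set r = set r) \<longleftrightarrow> (\<forall>k<length lam. w ` young_block lam k = young_block lam k)"
    unfolding all_set_conv_all_nth assms using young_block_chop_rows[of _ lam] by auto
  then show ?thesis using assms by (simp add: young_subgroup_def sym_group_carrier)
qed

text \<open>The conjugate of \<open>w\<close> by \<open>x\<close> lies in the Young subgroup iff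
  \<open>w\<close> preserves the images of the Young blocks under \<open>inv' x\<close>. Each
  ordered set partition arises from \<open>prod_list (map fact lam)\<close> elements
  \<open>x\<close>, which is the order of the subgroup and cancels the denominator of the induced
  character.\<close>

lemma eta_char_eq_block_sum:
  assumes w: "w permutes {1..sum_list lam}"
  shows "eta_char lam w = block_sum lam (\<lambda>I. of_bool (w ` I = I)) {1..sum_list lam}"
proof -
  define n where "n = sum_list lam"
  define V where "V = chop_rows lam [1..<Suc n]"
  let ?G = "sym_group n"
  let ?X = "{1..n}"
  let ?fix = "\<lambda>V. \<forall>r\<in>set V. w ` set r = set r"
  have setX: "set [1..<Suc n] = ?X" by auto
  have VX: "V \<in> tableaux lam ?X"
  proof -
    have "[1..<Suc n] \<in> {xs. distinct xs \<and> set xs = ?X \<and> length xs = sum_list lam}"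
      using setX by (simp add: n_def del: upt_Suc)
    then show ?thesis
      unfolding V_def by (rule bij_betwE[OF bij_betw_chop_rows, rule_format])
  qed
  note iff = young_subgroup_iff[OF n_def V_def]
  have young: "real (card (young_subgroup lam)) = prod_list (map fact lam)"
  proof -
    have "young_subgroup lam = {w. w permutes ?X \<and> (\<forall>r\<in>set V. w ` set r = set r)}"
      using iff by blast
    then show ?thesis using card_block_stabiliser[OF _ VX] by simp
  qed
  have conj: "x \<circ> w \<circ> inv' x \<in> young_subgroup lam \<longleftrightarrow> ?fix (map (map (inv' x)) V)"
    if x: "x permutes ?X" for x :: "nat \<Rightarrow> nat"
  proof -
    have "(x \<circ> w \<circ> inv' x) ` S = S \<longleftrightarrow> w ` inv' x ` S = inv' x ` S" for S
    proof -
      have "(x \<circ> w \<circ> inv' x) ` S = S \<longleftrightarrow> x ` w ` inv' x ` S = x ` inv' x ` S"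
        using image_f_inv_f[OF permutes_surj[OF x]] by (simp only: image_comp[symmetric])
      also have "\<dots> \<longleftrightarrow> w ` inv' x ` S = inv' x ` S"
        by (rule inj_image_eq_iff[OF permutes_inj[OF x]])
      finally show ?thesis .
    qed
    moreover have "x \<circ> w \<circ> inv' x permutes ?X"
      using x w n_def by (intro permutes_compose permutes_inv) auto
    ultimately show ?thesis by (simp add: iff)
  qed
  have "(\<Sum>x\<in>carrier ?G. (let y = x \<otimes>\<^bsub>?G\<^esub> w \<otimes>\<^bsub>?G\<^esub> (inv\<^bsub>?G\<^esub> x) in if y \<in> young_subgroup lam then 1 else 0)) =
      (\<Sum>x | x permutes ?X. of_bool (?fix (map (map (inv' x)) V)) :: real)"
  proof (rule sum.cong)
    fix x assume x: "x \<in> {x. x permutes ?X}"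
    then have "inv\<^bsub>?G\<^esub> x = inv' x" by (simp add: sym_group_carrier sym_group_inv_equality)
    then show "(let y = x \<otimes>\<^bsub>?G\<^esub> w \<otimes>\<^bsub>?G\<^esub> (inv\<^bsub>?G\<^esub> x) in if y \<in> young_subgroup lam then 1 else 0) =
        (of_bool (?fix (map (map (inv' x)) V)) :: real)"
      using conj x by (simp add: sym_group_mult del: set_map)
  qed (auto simp: sym_group_carrier)
  \<comment> \<open>Inversion permutes the group, so \<open>x\<close> may replace
    \<open>inv' x\<close>; the relabelled tableaux \<open>map (map x) V\<close> then run once
    through all tableaux.\<close>
  also have "\<dots> = (\<Sum>x | x permutes ?X. of_bool (?fix (map (map x) V)))"
    by (rule sum.reindex_bij_witness[where i = inv' and j = inv']) (auto simp: permutes_inv permutes_inv_inv)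
  also have "\<dots> = (\<Sum>U\<in>tableaux lam ?X. of_bool (?fix U))"
  proof (rule sum.reindex_bij_betw)
    have "bij_betw (chop_rows lam \<circ> (\<lambda>x. map x [1..<Suc n])) {x. x permutes ?X} (tableaux lam ?X)"
    proof (rule bij_betw_trans)
      show "bij_betw (\<lambda>x. map x [1..<Suc n]) {x. x permutes ?X} {r. distinct r \<and> set r = ?X}"
        using bij_betw_permutes_lists[of "[1..<Suc n]"] unfolding setX by simp
      have "{r. distinct r \<and> set r = ?X} = {xs. distinct xs \<and> set xs = ?X \<and> length xs = sum_list lam}"
        unfolding n_def by (intro Collect_cong) (metis card_atLeastAtMost diff_Suc_1 distinct_card)
      then show "bij_betw (chop_rows lam) {r. distinct r \<and> set r = ?X} (tableaux lam ?X)"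
        using bij_betw_chop_rows[of lam ?X] by (simp only:)
    qed
    then show "bij_betw (\<lambda>x. map (map x) V) {x. x permutes ?X} (tableaux lam ?X)"
      by (simp only: o_def chop_rows_map V_def)
  qed
  also have "\<dots> = real (card {U \<in> tableaux lam ?X. ?fix U})"
    using finite_tableaux[of ?X lam] by (simp add: sum.If_cases Int_def of_bool_def)
  also have "\<dots> = block_sum lam (\<lambda>I. real (card {r. distinct r \<and> set r = I \<and> w ` set r = set r})) ?X"
    by (simp add: card_tableaux_rows)
  \<comment> \<open>The \<open>fact (card I)\<close> orders of a row with entry set \<open>I\<close>
    are the source of the multiplicity.\<close>
  also have "\<dots> = block_sum lam (\<lambda>I. fact (card I) * of_bool (w ` I = I)) ?X"
  proof (rule block_sum_cong)
    fix I assume "I \<subseteq> ?X"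
    then have "card {r. distinct r \<and> set r = I} = fact (card I)"
      by (intro card_distinct_lists) (auto intro: finite_subset)
    moreover have "{r. distinct r \<and> set r = I \<and> w ` set r = set r} = (if w ` I = I then {r. distinct r \<and> set r = I} else {})"
      by auto
    ultimately show "real (card {r. distinct r \<and> set r = I \<and> w ` set r = set r}) = fact (card I) * of_bool (w ` I = I)"
      by simp
  qed
  also have "\<dots> = prod_list (map fact lam) * block_sum lam (\<lambda>I. of_bool (w ` I = I)) ?X"
    by (simp add: block_sum_of_fact)
  finally have "(\<Sum>x\<in>carrier ?G. (let y = x \<otimes>\<^bsub>?G\<^esub> w \<otimes>\<^bsub>?G\<^esub> (inv\<^bsub>?G\<^esub> x) in if y \<in> young_subgroup lam then 1 else 0)) =
      prod_list (map fact lam) * block_sum lam (\<lambda>I. of_bool (w ` I = I)) ?X" .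
  moreover have "prod_list (map fact lam) \<noteq> (0 :: real)" by (auto simp: prod_list_zero_iff)
  ultimately show ?thesis
    by (simp add: eta_char_def induced_class_function_def young n_def[symmetric])
qed

section \<open>Descent-free and excedance-free words\<close>

text \<open>Only pairs with \<open>i < j\<close> are tested, because the relations used here satisfy
  \<open>lt x y \<Longrightarrow> x < y\<close> and can relate two elements in no other
  direction.\<close>

definition chain_on :: "(nat \<Rightarrow> nat \<Rightarrow> bool) \<Rightarrow> nat set \<Rightarrow> bool" where
  "chain_on lt B \<longleftrightarrow> (\<forall>i\<in>B. \<forall>j\<in>B. i < j \<longrightarrow> lt i j)"

definition descent_free_words :: "(nat \<Rightarrow> nat \<Rightarrow> bool) \<Rightarrow> nat set \<Rightarrow> nat list set" where
  "descent_free_words lt I = {r. distinct r \<and> set r = I \<and> successively (\<lambda>x y. \<not> lt y x) r}"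

definition descending_words :: "(nat \<Rightarrow> nat \<Rightarrow> bool) \<Rightarrow> nat set \<Rightarrow> nat list set" where
  "descending_words lt B = {b. distinct b \<and> set b = B \<and> successively (\<lambda>x y. lt y x) b}"

lemma finite_words: "finite I \<Longrightarrow> finite {r. distinct r \<and> set r = I}"
  by (rule finite_subset[OF _ finite_subset_distinct]) auto

lemma finite_descent_free_words: "finite I \<Longrightarrow> finite (descent_free_words lt I)"
  by (rule finite_subset[OF _ finite_words]) (auto simp: descent_free_words_def)

lemma finite_descending_words: "finite I \<Longrightarrow> finite (descending_words lt I)"
  by (rule finite_subset[OF _ finite_words]) (auto simp: descending_words_def)

text \<open>The first letter of the descent-free word and the last letter of the descending word change
  places, whichever of the two moves is possible.\<close>

lemma signed_word_pairs_sum: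
  fixes lt :: "nat \<Rightarrow> nat \<Rightarrow> bool"
  assumes "finite I" "I \<noteq> {}"
  shows "(\<Sum>(b, u) | distinct (b @ u) \<and> set (b @ u) = I \<and>
      successively (\<lambda>x y. lt y x) b \<and> successively (\<lambda>x y. \<not> lt y x) u. (-1) ^ length b) = (0 :: real)"
proof -
  define S where "S = {(b, u). distinct (b @ u) \<and> set (b @ u) = I \<and>
      successively (\<lambda>x y. lt y x) b \<and> successively (\<lambda>x y. \<not> lt y x) u}"
  \<comment> \<open>\<open>A\<close> says that the first letter of \<open>u\<close> may be appended
    to \<open>b\<close>; when it fails, the last letter of \<open>b\<close> may be put in front of
    \<open>u\<close>. A move reverses the test: after appending, the next letter of \<open>u\<close>
    is not below the moved one as \<open>u\<close> was descent-free, and after prepending, the moved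
    letter is below its predecessor in \<open>b\<close>, if any.\<close>
  define A where "A b u \<longleftrightarrow> u \<noteq> [] \<and> (b = [] \<or> lt (hd u) (last b))" for b u
  define \<phi> where "\<phi> = (\<lambda>(b, u). if A b u then (b @ [hd u], tl u) else (butlast b, last b # u))"
  define sg where "sg = (\<lambda>(b :: nat list, u :: nat list). (-1 :: real) ^ length b)"
  have \<phi>: "\<phi> p \<in> S \<and> \<phi> (\<phi> p) = p \<and> sg (\<phi> p) = - sg p" if p: "p \<in> S" for p
  proof -
    obtain b u where bu: "p = (b, u)" by (cases p)
    have S: "distinct (b @ u)" "set (b @ u) = I"
      "successively (\<lambda>x y. lt y x) b" "successively (\<lambda>x y. \<not> lt y x) u"
      using p bu by (auto simp: S_def)
    show ?thesis
    proof (cases "A b u")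
      case True
      then obtain x u' where u: "u = x # u'" by (cases u) (auto simp: A_def)
      have eq: "\<phi> p = (b @ [x], u')" using True u bu by (simp add: \<phi>_def)
      have "successively (\<lambda>x y. lt y x) (b @ [x])"
        using True S(3) u by (auto simp: A_def successively_append_iff)
      then have "\<phi> p \<in> S"
        using S u eq by (auto simp: S_def successively_Cons)
      moreover have "\<not> A (b @ [x]) u'" using S(4) u by (auto simp: A_def successively_Cons)
      then have "\<phi> (\<phi> p) = p" unfolding eq by (simp add: \<phi>_def bu u)
      ultimately show ?thesis using eq bu by (simp add: sg_def)
    next
      case False
      then have "b \<noteq> []" using S(2) assms(2) by (auto simp: A_def)
      then obtain b' x where b: "b = b' @ [x]" by (metis rev_exhaust)
      have eq: "\<phi> p = (b', x # u)" using False b bu by (simp add: \<phi>_def)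
      have "successively (\<lambda>x y. \<not> lt y x) (x # u)"
        using False S(4) b by (auto simp: A_def successively_Cons)
      then have "\<phi> p \<in> S"
        using S b eq by (auto simp: S_def successively_append_iff)
      moreover have "A b' (x # u)" using S(3) b by (auto simp: A_def successively_append_iff)
      then have "\<phi> (\<phi> p) = p" unfolding eq by (simp add: \<phi>_def bu b)
      ultimately show ?thesis using eq bu b by (simp add: sg_def)
    qed
  qed
  have "sum sg S = (\<Sum>p\<in>S. sg (\<phi> p))"
    by (rule sum.reindex_bij_witness[where i = \<phi> and j = \<phi>]) (use \<phi> in auto)
  also have "\<dots> = - sum sg S" using \<phi> by (simp add: sum_negf)
  finally have "sum sg S = 0" by simp
  then show ?thesis unfolding S_def sg_def by (simp add: case_prod_unfold)
qed

text \<open>Labels decrease along such a word, so the decreasing list of \<open>B\<close> is the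
  only candidate. Writing the indicator of chains as a number of words makes the involution on pairs
  of words applicable.\<close>

lemma card_descending_words:
  assumes "finite B" and lt_less: "\<And>x y. lt x y \<Longrightarrow> x < y"
    and trans: "\<And>x y z. x \<in> B \<Longrightarrow> y \<in> B \<Longrightarrow> z \<in> B \<Longrightarrow> lt x y \<Longrightarrow> lt y z \<Longrightarrow> lt x z"
  shows "card (descending_words lt B) = of_bool (chain_on lt B)"
proof -
  let ?r = "rev (sorted_list_of_set B)"
  have uniq: "b = ?r" if "b \<in> descending_words lt B" for b
  proof -
    have b: "distinct b" "set b = B" "successively (\<lambda>x y. lt y x) b"
      using that by (auto simp: descending_words_def)
    have "successively (>) b"
      using b(3) by (rule successively_mono) (use lt_less in auto)
    then have "sorted_wrt (>) b"
      by (subst (asm) successively_iff_sorted_wrt_strong) (auto simp: transp_def)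
    then have "sorted_wrt (<) (rev b)" by (simp add: sorted_wrt_rev)
    then have "sorted_list_of_set B = rev b"
      using sorted_list_of_set_unique[OF assms(1), of "rev b"] b(2) distinct_card[OF b(1)] by simp
    then show ?thesis by simp
  qed
  have "?r \<in> descending_words lt B \<longleftrightarrow> chain_on lt B"
  proof
    assume "?r \<in> descending_words lt B"
    then have "successively (\<lambda>x y. lt y x) ?r" by (simp add: descending_words_def)
    \<comment> \<open>Transitivity carries the relation from neighbours to all pairs.\<close>
    moreover have "successively (\<lambda>x y. lt y x) ?r \<longleftrightarrow> sorted_wrt (\<lambda>x y. lt y x) ?r"
    proof (rule successively_iff_sorted_wrt_strong)
      show "lt z x" if "x \<in> set ?r" "y \<in> set ?r" "z \<in> set ?r" "lt y x" "lt z y" for x y z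
        using trans[of z y x] that assms(1) by simp
    qed
    ultimately have "sorted_wrt (\<lambda>x y. lt y x) ?r" by simp
    then have s: "sorted_wrt lt (sorted_list_of_set B)" by (simp add: sorted_wrt_rev)
    show "chain_on lt B"
      unfolding chain_on_def
    proof (intro ballI impI)
      fix i j assume ij: "i \<in> B" "j \<in> B" "i < j"
      define xs where "xs = sorted_list_of_set B"
      have "i \<in> set xs" "j \<in> set xs" using ij assms(1) by (simp_all add: xs_def)
      then obtain k l where kl: "k < length xs" "xs ! k = i" "l < length xs" "xs ! l = j"
        unfolding in_set_conv_nth by blast
      have "sorted xs" by (simp add: xs_def)
      then have "k < l" using kl ij(3) sorted_nth_mono[of xs l k] by (metis leD leI)
      then show "lt i j" using s kl unfolding xs_def[symmetric] by (metis sorted_wrt_nth_less)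
    qed
  next
    assume c: "chain_on lt B"
    have "sorted_wrt (<) (sorted_list_of_set B)" by simp
    then have "sorted_wrt lt (sorted_list_of_set B)"
      by (rule sorted_wrt_mono_rel[rotated]) (use c assms(1) in \<open>auto simp: chain_on_def\<close>)
    then have "successively (\<lambda>x y. lt y x) ?r"
      by (intro successively_if_sorted_wrt) (simp add: sorted_wrt_rev)
    then show "?r \<in> descending_words lt B" using assms(1) by (simp add: descending_words_def)
  qed
  then have "descending_words lt B = (if chain_on lt B then {?r} else {})"
    using uniq by auto
  then show ?thesis by simp
qed

text \<open>Summed over \<open>B\<close>, the terms enumerate the pairs in
  \<open>signed_word_pairs_sum\<close>, where \<open>B\<close> is recovered as the set of letters of
  the descending word.\<close>

lemma descent_free_recursion:
  assumes "finite I" "I \<noteq> {}" and lt_less: "\<And>x y. lt x y \<Longrightarrow> x < y"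
    and trans: "\<And>x y z. x \<in> I \<Longrightarrow> y \<in> I \<Longrightarrow> z \<in> I \<Longrightarrow> lt x y \<Longrightarrow> lt y z \<Longrightarrow> lt x z"
  shows "(\<Sum>B\<in>Pow I. (-1) ^ card B * of_bool (chain_on lt B) *
      real (card (descent_free_words lt (I - B)))) = 0"
proof -
  let ?S = "{(b, u). distinct (b @ u) \<and> set (b @ u) = I \<and>
      successively (\<lambda>x y. lt y x) b \<and> successively (\<lambda>x y. \<not> lt y x) u}"
  have "(\<Sum>B\<in>Pow I. (-1) ^ card B * of_bool (chain_on lt B) * real (card (descent_free_words lt (I - B)))) =
      (\<Sum>B\<in>Pow I. \<Sum>p\<in>descending_words lt B \<times> descent_free_words lt (I - B). (-1) ^ card B)"
  proof (rule sum.cong[OF refl])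
    fix B assume "B \<in> Pow I"
    then have BI: "B \<subseteq> I" and fin: "finite B" using assms(1) finite_subset by auto
    have "card (descending_words lt B) = of_bool (chain_on lt B)"
    proof (rule card_descending_words[OF fin lt_less])
      show "lt x z" if "x \<in> B" "y \<in> B" "z \<in> B" "lt x y" "lt y z" for x y z
        using trans[of x y z] that BI by blast
    qed
    then show "(-1) ^ card B * of_bool (chain_on lt B) * real (card (descent_free_words lt (I - B))) =
        (\<Sum>p\<in>descending_words lt B \<times> descent_free_words lt (I - B). (-1) ^ card B)"
      by (simp add: card_cartesian_product)
  qed
  also have "\<dots> = (\<Sum>(B, p)\<in>(SIGMA B:Pow I. descending_words lt B \<times> descent_free_words lt (I - B)). (-1) ^ card B)"
  proof (rule sum.Sigma)
    show "finite (Pow I)" using assms(1) by simp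
    show "\<forall>B\<in>Pow I. finite (descending_words lt B \<times> descent_free_words lt (I - B))"
      using assms(1) by (auto intro!: finite_descending_words finite_descent_free_words intro: finite_subset)
  qed
  also have "\<dots> = (\<Sum>(b, u)\<in>?S. (-1) ^ length b)"
    by (rule sum.reindex_bij_witness[where i = "\<lambda>(b, u). (set b, (b, u))" and j = snd])
      (auto simp: descending_words_def descent_free_words_def distinct_card)
  also have "\<dots> = 0" using signed_word_pairs_sum[OF assms(1,2), of lt] .
  finally show ?thesis .
qed

section \<open>Excedance-free words through permanents and determinants\<close>

definition excedance_free_words :: "(nat \<Rightarrow> nat \<Rightarrow> bool) \<Rightarrow> nat set \<Rightarrow> nat list set" where
  "excedance_free_words lt I =
    {r. distinct r \<and> set r = I \<and> (\<forall>j<length r. \<not> lt (sort r ! j) (r ! j))}"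

text \<open>Read against the sorted list, a word is a permutation \<open>w\<close>, and the
  condition at the position of \<open>i\<close> is \<open>\<not> lt i (w i)\<close>. The product of
  the 0-1 entries tests all positions at once.\<close>

lemma card_excedance_free_words:
  assumes "finite I"
  shows "real (card (excedance_free_words lt I)) = perm_on (\<lambda>i j. of_bool (\<not> lt i j)) I"
proof -
  let ?xs = "sorted_list_of_set I"
  let ?W = "{w. w permutes I}"
  let ?P = "\<lambda>w. \<forall>i\<in>I. \<not> lt i (w i)"
  have finW: "finite ?W" using assms finite_permutations by blast
  have xs: "distinct ?xs" "set ?xs = I" using assms by auto
  have bij: "bij_betw (\<lambda>w. map w ?xs) ?W {r. distinct r \<and> set r = I}"
    using bij_betw_permutes_lists[OF xs(1)] unfolding xs(2) .
  have sort: "sort r = ?xs" if "distinct r" "set r = I" for r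
    using that by (metis distinct_remdups_id sorted_list_of_set_sort_remdups)
  have good: "map w ?xs \<in> excedance_free_words lt I \<longleftrightarrow> ?P w" if w: "w \<in> ?W" for w
  proof -
    have m: "distinct (map w ?xs)" "set (map w ?xs) = I"
      using bij_betwE[OF bij] w by auto
    have "(\<forall>j<length ?xs. \<not> lt (?xs ! j) (w (?xs ! j))) \<longleftrightarrow> (\<forall>i\<in>set ?xs. \<not> lt i (w i))"
      by (simp only: all_set_conv_all_nth)
    then show ?thesis using m sort[OF m] xs by (simp add: excedance_free_words_def)
  qed
  have "bij_betw (\<lambda>w. map w ?xs) {w \<in> ?W. ?P w} (excedance_free_words lt I)"
  proof (rule bij_betw_imageI)
    show "inj_on (\<lambda>w. map w ?xs) {w \<in> ?W. ?P w}"
      using bij by (auto simp: bij_betw_def inj_on_def)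
    show "(\<lambda>w. map w ?xs) ` {w \<in> ?W. ?P w} = excedance_free_words lt I"
    proof
      show "(\<lambda>w. map w ?xs) ` {w \<in> ?W. ?P w} \<subseteq> excedance_free_words lt I"
        using good by blast
      show "excedance_free_words lt I \<subseteq> (\<lambda>w. map w ?xs) ` {w \<in> ?W. ?P w}"
      proof
        fix r assume r: "r \<in> excedance_free_words lt I"
        then have "r \<in> (\<lambda>w. map w ?xs) ` ?W"
          using bij by (simp add: bij_betw_def excedance_free_words_def)
        then obtain w where "w \<in> ?W" "r = map w ?xs" by blast
        then show "r \<in> (\<lambda>w. map w ?xs) ` {w \<in> ?W. ?P w}" using good r by blast
      qed
    qed
  qed
  then have "real (card (excedance_free_words lt I)) = real (card {w \<in> ?W. ?P w})"
    by (simp add: bij_betw_same_card)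
  also have "\<dots> = (\<Sum>w\<in>?W. of_bool (?P w))"
    using finW by (simp add: sum.If_cases Int_def of_bool_def)
  also have "\<dots> = perm_on (\<lambda>i j. of_bool (\<not> lt i j)) I"
    unfolding perm_on_def
  proof (rule sum.cong[OF refl])
    fix w
    show "of_bool (?P w) = (\<Prod>i\<in>I. of_bool (\<not> lt i (w i)) :: real)"
      using assms by (cases "?P w") (auto simp: prod_zero_iff)
  qed
  finally show ?thesis .
qed

lemma det_on_equal_rows:
  assumes "finite B" "a \<in> B" "b \<in> B" "a \<noteq> b" "\<And>x. A a x = A b x"
  shows "det_on A B = 0"
proof -
  let ?\<tau> = "Transposition.transpose a b"
  let ?g = "\<lambda>w. of_int (sign w) * (\<Prod>i\<in>B. A i (w i)) :: real"
  have \<tau>: "?\<tau> permutes B" using assms by (simp add: permutes_swap_id)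
  have flip: "?g (w \<circ> ?\<tau>) = - ?g w" if "w permutes B" for w
  proof -
    have "permutation w" using that assms(1) permutation_permutes by blast
    then have s: "sign (w \<circ> ?\<tau>) = - sign w"
      using assms(4) by (simp add: sign_compose permutation_swap_id sign_swap_id)
    have "(\<Prod>i\<in>B. A i ((w \<circ> ?\<tau>) i)) = (\<Prod>i\<in>B. A (?\<tau> i) (w (?\<tau> i)))"
      using assms(5) by (intro prod.cong) (auto simp: Transposition.transpose_def)
    also have "\<dots> = (\<Prod>i\<in>B. A i (w i))"
      by (rule prod.permute[OF \<tau>, unfolded o_def, symmetric])
    finally show ?thesis using s by simp
  qed
  have "det_on A B = (\<Sum>w | w permutes B. ?g (w \<circ> ?\<tau>))"
    unfolding det_on_def
    by (rule sum.reindex_bij_witness[where i = "\<lambda>w. w \<circ> ?\<tau>" and j = "\<lambda>w. w \<circ> ?\<tau>"])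
      (auto simp: comp_assoc intro: permutes_compose[OF \<tau>])
  also have "\<dots> = - det_on A B"
    using flip by (simp add: det_on_def sum_negf)
  finally show ?thesis by simp
qed

text \<open>Two maximal elements give two equal rows; a single one is comparable to all others, so that its
  column is a unit vector.\<close>

lemma det_on_incomparability:
  assumes "finite B" and lt_less: "\<And>x y. lt x y \<Longrightarrow> x < y"
    and trans: "\<And>x y z. x \<in> B \<Longrightarrow> y \<in> B \<Longrightarrow> z \<in> B \<Longrightarrow> lt x y \<Longrightarrow> lt y z \<Longrightarrow> lt x z"
  shows "det_on (\<lambda>i j. of_bool (\<not> lt i j)) B = of_bool (chain_on lt B)"
  using assms(1) trans
proof (induction B rule: finite_psubset_induct)
  case (psubset B)
  let ?A = "\<lambda>i j. of_bool (\<not> lt i j) :: real"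
  show ?case
  proof (cases "B = {}")
    case False
    \<comment> \<open>As \<open>lt\<close> respects the numerical order, the largest label is a
      maximal element.\<close>
    define m where "m = Max B"
    have m: "m \<in> B" "\<And>x. x \<in> B \<Longrightarrow> x \<le> m" using False psubset.hyps by (auto simp: m_def)
    have m_max: "\<not> lt m x" if "x \<in> B" for x using m(2)[OF that] lt_less by fastforce
    show ?thesis
    proof (cases "\<exists>a\<in>B - {m}. \<forall>x\<in>B. \<not> lt a x")
      case True
      then obtain a where a: "a \<in> B" "a \<noteq> m" "\<And>x. x \<in> B \<Longrightarrow> \<not> lt a x" by blast
      \<comment> \<open>\<open>det_on_equal_rows\<close> wants the rows to agree at all column
        indices, also outside \<open>B\<close>. Setting the entries to 0 there achieves this without
        changing the determinant.\<close>
      define A' where "A' i j = (if j \<in> B then ?A i j else 0)" for i j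
      have "det_on ?A B = det_on A' B"
        unfolding det_on_def A'_def
        by (intro sum.cong refl arg_cong2[where f = "(*)"] prod.cong) (auto simp: permutes_in_image)
      also have "\<dots> = 0"
        using psubset.hyps m(1) a m_max by (intro det_on_equal_rows[of B a m]) (auto simp: A'_def)
      moreover have "\<not> chain_on lt B"
        using a(1,2) m(1) m(2)[OF a(1)] a(3)[OF m(1)] unfolding chain_on_def
        by (metis order.not_eq_order_implies_strict)
      ultimately show ?thesis by simp
    next
      case False
      then have above: "\<exists>x\<in>B. lt a x" if "a \<in> B - {m}" for a using that by blast
      \<comment> \<open>Climbing from \<open>a\<close> raises the label, and the climb can end only
        at \<open>m\<close>.\<close>
      have top: "lt a m" if "a \<in> B" "a \<noteq> m" for a
        using that
      proof (induction "m - a" arbitrary: a rule: less_induct)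
        case less
        then obtain x where x: "x \<in> B" "lt a x" using above by blast
        show ?case
        proof (cases "x = m")
          case False
          have "a < x" using x lt_less by blast
          moreover have "x < m" using m(2)[OF x(1)] False by simp
          ultimately have "lt x m" using less.hyps[of x] x False by simp
          then show ?thesis using psubset.prems[of a x m] less.prems x m by blast
        qed (use x in simp)
      qed
      let ?W = "{w. w permutes B}" and ?W' = "{w. w permutes B - {m}}"
      let ?g = "\<lambda>w. of_int (sign w) * (\<Prod>i\<in>B. ?A i (w i)) :: real"
      have "det_on ?A B = (\<Sum>w\<in>?W'. ?g w)"
        unfolding det_on_def
      proof (rule sum.mono_neutral_right)
        show "finite ?W" using psubset.hyps finite_permutations by blast
        show "?W' \<subseteq> ?W" by (auto intro: permutes_subset)
        \<comment> \<open>A permutation moving \<open>m\<close> uses an entry of column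
          \<open>m\<close> outside row \<open>m\<close>, and these vanish because \<open>m\<close>
          is the greatest element.\<close>
        show "\<forall>w\<in>?W - ?W'. ?g w = 0"
        proof
          fix w assume w: "w \<in> ?W - ?W'"
          then have "w m \<noteq> m" by (auto simp: permutes_def)
          obtain i where i: "w i = m" using w permutes_surj by (metis Diff_iff mem_Collect_eq surjD)
          have "i \<in> B" using w i m(1) permutes_in_image by fastforce
          moreover have "i \<noteq> m" using i \<open>w m \<noteq> m\<close> by auto
          ultimately have "lt i (w i)" using top i by simp
          then have "(\<Prod>i\<in>B. ?A i (w i)) = 0" using \<open>i \<in> B\<close> psubset.hyps by (intro prod_zero) auto
          then show "?g w = 0" by simp
        qed
      qed
      also have "\<dots> = det_on ?A (B - {m})"
        unfolding det_on_def
      proof (rule sum.cong[OF refl])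
        fix w assume "w \<in> ?W'"
        then have "w m = m" by (auto simp: permutes_def)
        then show "?g w = of_int (sign w) * (\<Prod>i\<in>B - {m}. ?A i (w i))"
          using prod.remove[OF psubset.hyps m(1), of "\<lambda>i. ?A i (w i)"] m_max[OF m(1)] by simp
      qed
      also have "\<dots> = of_bool (chain_on lt (B - {m}))"
      proof (rule psubset.IH)
        show "B - {m} \<subset> B" using m(1) by blast
        show "lt x z" if "x \<in> B - {m}" "y \<in> B - {m}" "z \<in> B - {m}" "lt x y" "lt y z" for x y z
          using psubset.prems[of x y z] that by blast
      qed
      also have "chain_on lt (B - {m}) \<longleftrightarrow> chain_on lt B"
      proof
        assume c: "chain_on lt (B - {m})"
        show "chain_on lt B"
          unfolding chain_on_def
        proof (intro ballI impI)
          fix i j assume ij: "i \<in> B" "j \<in> B" "i < j"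
          then have "i \<noteq> m" using m(2)[of j] by auto
          then show "lt i j" using c top ij by (cases "j = m") (auto simp: chain_on_def)
        qed
      qed (auto simp: chain_on_def)
      finally show ?thesis .
    qed
  qed (simp add: chain_on_def)
qed

text \<open>Both numbers are the solution of the same signed recursion over the chains in \<open>X\<close>.\<close>

lemma card_excedance_free_eq_descent_free:
  assumes "finite X" and lt_less: "\<And>x y. lt x y \<Longrightarrow> x < y"
    and trans: "\<And>x y z. x \<in> X \<Longrightarrow> y \<in> X \<Longrightarrow> z \<in> X \<Longrightarrow> lt x y \<Longrightarrow> lt y z \<Longrightarrow> lt x z"
  shows "card (excedance_free_words lt X) = card (descent_free_words lt X)"
proof -
  let ?A = "\<lambda>i j. of_bool (\<not> lt i j) :: real"
  have "perm_on ?A X = real (card (descent_free_words lt X))"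
  proof (rule signed_convolution_unique[OF assms(1), where e = "\<lambda>B. of_bool (chain_on lt B)"])
    show "of_bool (chain_on lt {}) = (1 :: real)" by (simp add: chain_on_def)
    have "descent_free_words lt {} = {[]}" by (auto simp: descent_free_words_def)
    then show "perm_on ?A {} = real (card (descent_free_words lt {}))" by simp
  next
    fix I assume I: "I \<subseteq> X" "I \<noteq> {}"
    then have fin: "finite I" using assms(1) finite_subset by blast
    show "(\<Sum>B\<in>Pow I. (-1) ^ card B * of_bool (chain_on lt B) * real (card (descent_free_words lt (I - B)))) = 0"
    proof (rule descent_free_recursion[OF fin I(2) lt_less])
      show "lt x z" if "x \<in> I" "y \<in> I" "z \<in> I" "lt x y" "lt y z" for x y z
        using trans[of x y z] that I(1) by blast
    qed
    have "(\<Sum>B\<in>Pow I. (-1) ^ card B * of_bool (chain_on lt B) * perm_on ?A (I - B)) =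
        (\<Sum>B\<in>Pow I. (-1) ^ card B * det_on ?A B * perm_on ?A (I - B))"
    proof (rule sum.cong[OF refl])
      fix B assume "B \<in> Pow I"
      then have BX: "B \<subseteq> X" and finB: "finite B" using I fin finite_subset by auto
      have "det_on ?A B = of_bool (chain_on lt B)"
      proof (rule det_on_incomparability[OF finB lt_less])
        show "lt x z" if "x \<in> B" "y \<in> B" "z \<in> B" "lt x y" "lt y z" for x y z
          using trans[of x y z] that BX by blast
      qed
      then show "(-1) ^ card B * of_bool (chain_on lt B) * perm_on ?A (I - B) =
          (-1) ^ card B * det_on ?A B * perm_on ?A (I - B)" by simp
    qed
    then show "(\<Sum>B\<in>Pow I. (-1) ^ card B * of_bool (chain_on lt B) * perm_on ?A (I - B)) = 0"
      using muir_identity[OF fin I(2), of ?A] by simp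
  qed
  then show ?thesis using card_excedance_free_words[OF assms(1), of lt] by simp
qed

section \<open>Curves in the disc\<close>

lemma cis_neq:
  fixes a b :: real
  assumes "b < a" "a - b < 2 * pi"
  shows "cis a \<noteq> cis b"
proof
  assume "cis a = cis b"
  then have "cis (a - b) = 1" by (simp add: cis_divide[symmetric])
  then have "cos (a - b) = 1" by (metis cis.sel(1) one_complex.sel(1))
  then obtain k :: int where "a - b = of_int k * 2 * pi" using cos_one_2pi_int by blast
  then have k: "0 < of_int k * (2 * pi)" "of_int k * (2 * pi) < 1 * (2 * pi)"
    using assms by (simp_all only: mult.assoc)
  then have "(of_int k :: real) < 1" by (subst (asm) mult_less_cancel_right_pos) auto
  moreover have "0 < (of_int k :: real)" using k(1) pi_gt_zero by (simp only: zero_less_mult_iff) auto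
  ultimately show False by simp
qed

text \<open>On the circle of radius 2 the Cayley transform with pole \<open>2 * cis m\<close> is
  real and depends on the half-angle. At the pole both sides are 0 by the convention for division by
  zero.\<close>

lemma cayley_cis:
  "\<i> * (2 * cis m + 2 * cis \<alpha>) / (2 * cis m - 2 * cis \<alpha>) = - complex_of_real (cot ((\<alpha> - m) / 2))"
proof -
  define \<phi> \<mu> where "\<phi> = (\<alpha> - m) / 2" and "\<mu> = (\<alpha> + m) / 2"
  have e: "cis m = cis \<mu> * cis (- \<phi>)" "cis \<alpha> = cis \<mu> * cis \<phi>"
    by (simp_all add: cis_mult \<phi>_def \<mu>_def field_simps)
  have "2 * cis m + 2 * cis \<alpha> = 2 * cis \<mu> * (cis (- \<phi>) + cis \<phi>)"
    unfolding e by (simp only: distrib_left mult.assoc)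
  also have "cis (- \<phi>) + cis \<phi> = 2 * cos \<phi>" by (simp add: complex_eq_iff)
  finally have p: "2 * cis m + 2 * cis \<alpha> = 2 * cis \<mu> * (2 * cos \<phi>)" .
  have "2 * cis m - 2 * cis \<alpha> = 2 * cis \<mu> * (cis (- \<phi>) - cis \<phi>)"
    unfolding e by (simp only: right_diff_distrib mult.assoc)
  also have "cis (- \<phi>) - cis \<phi> = \<i> * (- 2 * sin \<phi>)" by (simp add: complex_eq_iff)
  finally have q: "2 * cis m - 2 * cis \<alpha> = 2 * cis \<mu> * (\<i> * (- 2 * sin \<phi>))" .
  have "\<i> * (2 * cis \<mu> * (2 * cos \<phi>)) / (2 * cis \<mu> * (\<i> * (- 2 * sin \<phi>))) = - (cos \<phi> / sin \<phi>)"
    by (cases "sin \<phi> = 0") (simp_all add: field_simps)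
  then show ?thesis unfolding p q by (simp add: cot_def \<phi>_def)
qed

lemma cot_decreasing:
  assumes "0 < x" "x < y" "y < pi"
  shows "cot y < cot x"
proof -
  have s: "0 < sin x" "0 < sin y" "0 < sin (y - x)" using assms by (auto intro!: sin_gt_zero)
  have "cot x - cot y = sin (y - x) / (sin x * sin y)"
    using s by (simp add: cot_def sin_diff field_simps)
  then show ?thesis using s by (metis diff_gt_0_iff_gt divide_pos_pos mult_pos_pos)
qed

lemma path_image_radial:
  "path_image (linepath (2 * cis x) (cis x)) \<subseteq> {of_real r * cis x | r. 1 \<le> r \<and> r \<le> 2}"
  "path_image (linepath (cis x) (2 * cis x)) \<subseteq> {of_real r * cis x | r. 1 \<le> r \<and> r \<le> 2}"
proof -
  have "closed_segment (cis x) (2 * cis x) \<subseteq> {of_real r * cis x | r. 1 \<le> r \<and> r \<le> 2}"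
  proof
    fix z assume "z \<in> closed_segment (cis x) (2 * cis x)"
    then obtain u where "0 \<le> u" "u \<le> 1" "z = (1 - u) *\<^sub>R cis x + u *\<^sub>R (2 * cis x)"
      unfolding closed_segment_def by auto
    then have "z = of_real (1 + u) * cis x \<and> 1 \<le> 1 + u \<and> 1 + u \<le> 2"
      by (simp add: scaleR_conv_of_real algebra_simps)
    then show "z \<in> {of_real r * cis x | r. 1 \<le> r \<and> r \<le> 2}" by blast
  qed
  then show "path_image (linepath (2 * cis x) (cis x)) \<subseteq> {of_real r * cis x | r. 1 \<le> r \<and> r \<le> 2}"
    "path_image (linepath (cis x) (2 * cis x)) \<subseteq> {of_real r * cis x | r. 1 \<le> r \<and> r \<le> 2}"
    by (simp_all add: closed_segment_commute)
qed

text \<open>The curves may run along the unit circle. Radial segments outside the disc are attached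
  to them, so that in the disc of radius 2 they touch the boundary only at their ends; a Cayley
  transform then takes that disc to the upper half-plane, where \<open>fashoda_interlace\<close> applies.\<close>

lemma disc_paths_cross:
  fixes f g :: "real \<Rightarrow> complex" and a b c d :: real
  assumes "path f" "path g" "path_image f \<subseteq> cball 0 1" "path_image g \<subseteq> cball 0 1"
    and f: "pathstart f = cis a" "pathfinish f = cis c"
    and g: "pathstart g = cis b" "pathfinish g = cis d"
    and ord: "b < a" "c < b" "d < c" "a - d < 2 * pi"
  shows "path_image f \<inter> path_image g \<noteq> {}"
proof -
  \<comment> \<open>The angle \<open>m\<close> is the middle of the arc from \<open>d\<close> down
    to \<open>a - 2 * pi\<close>, which contains none of the four ends. Measured from
    \<open>m\<close>, the ends have half-angles in the interval from 0 to \<open>pi\<close>, where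
    \<open>cot\<close> decreases.\<close>
  define m where "m = (d + (a - 2 * pi)) / 2"
  have m: "a - 2 * pi < m" "m < d" using ord by (auto simp: m_def)
  define W where "W = 2 * cis m"
  define C where "C z = \<i> * (W + z) / (W - z)" for z
  \<comment> \<open>The minus sign turns decreasing angles into increasing first coordinates, the
    order expected by \<open>fashoda_interlace\<close>.\<close>
  define h :: "complex \<Rightarrow> real ^ 2" where "h z = (\<chi> i. if i = 1 then - Re (C z) else Im (C z))" for z
  define F where "F = linepath (2 * cis a) (cis a) +++ f +++ linepath (cis c) (2 * cis c)"
  define G where "G = linepath (2 * cis b) (cis b) +++ g +++ linepath (cis d) (2 * cis d)"
  define R where "R x = {of_real r * cis x | r. 1 \<le> r \<and> r \<le> 2}" for x :: real
  have pF: "path F" "path G" unfolding F_def G_def using assms by auto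
  have "path_image F = path_image (linepath (2 * cis a) (cis a)) \<union> path_image f \<union> path_image (linepath (cis c) (2 * cis c))"
    "path_image G = path_image (linepath (2 * cis b) (cis b)) \<union> path_image g \<union> path_image (linepath (cis d) (2 * cis d))"
    unfolding F_def G_def using f g by (auto simp: path_image_join)
  then have imF: "path_image F \<subseteq> R a \<union> path_image f \<union> R c"
    and imG: "path_image G \<subseteq> R b \<union> path_image g \<union> R d"
    using path_image_radial unfolding R_def by blast+
  define K where "K = {z. norm z \<le> 2 \<and> z \<noteq> W}"
  have RK: "R x \<subseteq> K" if "d \<le> x" "x \<le> a" for x
  proof
    fix z assume "z \<in> R x"
    then obtain r where r: "z = of_real r * cis x" "1 \<le> r" "r \<le> 2" unfolding R_def by blast
    have nz: "norm z = r" using r by (simp add: norm_mult)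
    moreover have "z \<noteq> W"
    proof
      assume "z = W"
      moreover then have "r = 2" using nz by (simp add: W_def norm_mult)
      ultimately have "cis x = cis m" using r by (simp add: W_def)
      then show False using cis_neq[of m x] m that by auto
    qed
    ultimately show "z \<in> K" using r by (simp add: K_def)
  qed
  have "cball 0 1 \<subseteq> K" by (auto simp: K_def W_def norm_mult)
  then have im: "path_image f \<subseteq> K" "path_image g \<subseteq> K" using assms(3,4) by auto
  have FK: "path_image F \<subseteq> K"
    using ord by (intro order_trans[OF imF] Un_least RK im) auto
  have GK: "path_image G \<subseteq> K"
    using ord by (intro order_trans[OF imG] Un_least RK im) auto
  have contC: "continuous_on K C"
    unfolding C_def by (intro continuous_intros) (auto simp: K_def)
  have conth: "continuous_on K h"
  proof -
    have "continuous_on K (\<lambda>z. if i = 1 then - Re (C z) else Im (C z))" for i :: 2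
      using contC by (cases "i = 1") (auto intro!: continuous_intros)
    then show ?thesis unfolding h_def by (intro continuous_on_vec_lambda)
  qed
  have h_inj: "inj_on h K"
  proof (rule inj_onI)
    fix u v assume uv: "u \<in> K" "v \<in> K" "h u = h v"
    have "Re (C u) = Re (C v)" "Im (C u) = Im (C v)"
      using arg_cong[OF uv(3), of "\<lambda>x. x $ 1"] arg_cong[OF uv(3), of "\<lambda>x. x $ 2"] by (simp_all add: h_def)
    then have "C u = C v" by (simp add: complex_eq_iff)
    moreover have "W - u \<noteq> 0" "W - v \<noteq> 0" using uv by (auto simp: K_def)
    ultimately have "(W + u) * (W - v) = (W + v) * (W - u)"
      by (simp add: C_def frac_eq_eq)
    then have "2 * W * u = 2 * W * v" by (simp add: algebra_simps)
    then show "u = v" by (simp add: W_def)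
  qed
  have h2: "0 \<le> h z $ 2" if "z \<in> K" for z
  proof -
    have "Im (C z) = Re ((W + z) / (W - z))"
      unfolding C_def by (simp only: times_divide_eq_right[symmetric] Im_i_times)
    also have "\<dots> = Re ((W + z) * cnj (W - z)) / (cmod (W - z))\<^sup>2"
      by (subst complex_div_cnj) (simp only: Re_divide_of_real)
    also have "Re ((W + z) * cnj (W - z)) = (cmod W)\<^sup>2 - (cmod z)\<^sup>2"
      unfolding cmod_power2 by (simp add: algebra_simps power2_eq_square)
    finally have "Im (C z) = ((cmod W)\<^sup>2 - (cmod z)\<^sup>2) / (cmod (W - z))\<^sup>2" .
    moreover have "(cmod z)\<^sup>2 \<le> (cmod W)\<^sup>2" using that by (intro power_mono) (auto simp: K_def W_def norm_mult)
    ultimately show ?thesis by (simp add: h_def)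
  qed
  have hcis: "h (2 * cis x) $ 1 = cot ((x - m) / 2)" "h (2 * cis x) $ 2 = 0" for x
    using cayley_cis[of m x] by (simp_all add: h_def C_def W_def)
  have p': "path (h \<circ> F)" "path (h \<circ> G)"
    using path_continuous_image[OF pF(1) continuous_on_subset[OF conth FK]]
      path_continuous_image[OF pF(2) continuous_on_subset[OF conth GK]] by auto
  have "bounded (path_image (h \<circ> F) \<union> path_image (h \<circ> G))"
    using p' by (simp add: bounded_path_image)
  then obtain M where M: "\<And>x. x \<in> path_image (h \<circ> F) \<union> path_image (h \<circ> G) \<Longrightarrow> norm x \<le> M"
    unfolding bounded_iff by blast
  \<comment> \<open>The lower edge of the box is at height 0, and the four outer ends are mapped
    onto it.\<close>
  define lo hi :: "real ^ 2" where "lo = (\<chi> i. if i = 1 then - M else 0)" and "hi = (\<chi> i. M)"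
  have box: "h z \<in> cbox lo hi" if "z \<in> path_image F \<union> path_image G" for z
  proof -
    have "norm (h z) \<le> M" using M that by (auto simp: path_image_compose)
    then have "\<bar>h z $ 1\<bar> \<le> M" "\<bar>h z $ 2\<bar> \<le> M" using component_le_norm_cart order_trans by blast+
    then show ?thesis using h2[of z] FK GK that
      by (auto simp: mem_box_cart forall_2 lo_def hi_def)
  qed
  have ends: "pathstart (h \<circ> F) = h (2 * cis a)" "pathfinish (h \<circ> F) = h (2 * cis c)"
    "pathstart (h \<circ> G) = h (2 * cis b)" "pathfinish (h \<circ> G) = h (2 * cis d)"
    by (simp_all add: F_def G_def pathstart_compose pathfinish_compose)
  obtain z where "z \<in> path_image (h \<circ> F)" "z \<in> path_image (h \<circ> G)"
  proof (rule fashoda_interlace[OF p', of lo hi])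
    show "path_image (h \<circ> F) \<subseteq> cbox lo hi" "path_image (h \<circ> G) \<subseteq> cbox lo hi"
      using box by (auto simp: path_image_compose)
    show "pathstart (h \<circ> F) $ 1 < pathstart (h \<circ> G) $ 1" "pathstart (h \<circ> G) $ 1 < pathfinish (h \<circ> F) $ 1"
      "pathfinish (h \<circ> F) $ 1 < pathfinish (h \<circ> G) $ 1"
      unfolding ends hcis using m ord by (intro cot_decreasing; simp)+
  qed (simp_all add: ends hcis lo_def)
  then obtain u v where uv: "u \<in> path_image F" "v \<in> path_image G" "h u = h v"
    by (auto simp: path_image_compose)
  then have "u = v" using h_inj FK GK by (meson inj_onD subsetD)
  with uv have u: "u \<in> path_image F" "u \<in> path_image G" by auto
  have ends_mem: "cis a \<in> path_image f" "cis c \<in> path_image f" "cis b \<in> path_image g" "cis d \<in> path_image g"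
    using f g pathstart_in_path_image pathfinish_in_path_image by metis+
  have on_circle: "z = cis x" if "z \<in> R x" "norm z \<le> 1" for z x
    using that by (auto simp: R_def norm_mult)
  have disjoint: False if "z \<in> R x" "z \<in> R y" "y < x" "x - y < 2 * pi" for z x y
  proof -
    from that(1) obtain r where r: "z = of_real r * cis x" "1 \<le> r" unfolding R_def by blast
    from that(2) obtain q where q: "z = of_real q * cis y" "1 \<le> q" unfolding R_def by blast
    have "norm z = r" unfolding r(1) using r(2) by (simp add: norm_mult)
    moreover have "norm z = q" unfolding q(1) using q(2) by (simp add: norm_mult)
    ultimately have "of_real r * cis x = of_real r * cis y" using r(1) q(1) by metis
    then have "cis x = cis y" using r(2) by (metis mult_cancel_left of_real_eq_0_iff not_one_le_zero)
    then show False using cis_neq[of y x] that(3,4) by blast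
  qed
  have uf: "u \<in> R a \<or> u \<in> path_image f \<or> u \<in> R c"
    and ug: "u \<in> R b \<or> u \<in> path_image g \<or> u \<in> R d"
    using u imF imG by blast+
  \<comment> \<open>The added segments at different angles are disjoint, so a common point cannot
    lie outside the unit disc. Inside it a segment contributes only its inner end, which already
    belongs to the curve.\<close>
  have "norm u \<le> 1"
  proof (rule ccontr)
    assume "\<not> norm u \<le> 1"
    then have "u \<notin> path_image f" "u \<notin> path_image g" using assms(3,4) by auto
    with uf ug have "u \<in> R a \<or> u \<in> R c" "u \<in> R b \<or> u \<in> R d" by blast+
    moreover have L: "a - b < 2 * pi" "d < a" "b - c < 2 * pi" "c - d < 2 * pi"
      using ord by auto
    have "\<not> (u \<in> R a \<and> u \<in> R b)" "\<not> (u \<in> R a \<and> u \<in> R d)"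
      "\<not> (u \<in> R b \<and> u \<in> R c)" "\<not> (u \<in> R c \<and> u \<in> R d)"
      using disjoint[OF _ _ ord(1) L(1)] disjoint[OF _ _ L(2) ord(4)]
        disjoint[OF _ _ ord(2) L(3)] disjoint[OF _ _ ord(3) L(4)] by blast+
    ultimately show False by blast
  qed
  note circ = on_circle[OF _ this]
  have "u \<in> path_image f" using uf circ ends_mem(1,2) by (elim disjE) simp_all
  moreover have "u \<in> path_image g" using ug circ ends_mem(3,4) by (elim disjE) simp_all
  ultimately show ?thesis by blast
qed

section \<open>Paths in planar networks\<close>

context planar_network
begin

section \<open>Sources and sinks on the boundary\<close>

lemma embedding_angles:
  assumes "disc_embedding D n s t \<phi> \<gamma>"
  obtains \<theta> :: "nat \<Rightarrow> real" where "\<forall>k\<in>{1..2 * n}. \<phi> (boundary_vertex n s t k) = cis (\<theta> k)"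
    "\<forall>k\<in>{1..2 * n}. \<forall>l\<in>{1..2 * n}. k < l \<longrightarrow> \<theta> l < \<theta> k \<and> \<theta> k - \<theta> l < 2 * pi"
  using assms unfolding disc_embedding_def by (elim conjE exE)

lemma boundary_vertex_inj:
  assumes "k \<in> {1..2 * n}" "l \<in> {1..2 * n}" "k < l"
  shows "boundary_vertex n s t k \<noteq> boundary_vertex n s t l"
proof -
  obtain \<phi> \<gamma> where emb: "disc_embedding D n s t \<phi> \<gamma>" using embeddable by blast
  obtain \<theta> where \<theta>: "\<forall>k\<in>{1..2 * n}. \<phi> (boundary_vertex n s t k) = cis (\<theta> k)"
    "\<forall>k\<in>{1..2 * n}. \<forall>l\<in>{1..2 * n}. k < l \<longrightarrow> \<theta> l < \<theta> k \<and> \<theta> k - \<theta> l < 2 * pi"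
    using embedding_angles[OF emb] .
  have "\<theta> l < \<theta> k" "\<theta> k - \<theta> l < 2 * pi" using \<theta>(2) assms by blast+
  then have "cis (\<theta> k) \<noteq> cis (\<theta> l)" by (rule cis_neq)
  then show ?thesis using \<theta>(1) assms by metis
qed

lemma source_neq: "i \<in> {1..n} \<Longrightarrow> j \<in> {1..n} \<Longrightarrow> i < j \<Longrightarrow> s i \<noteq> s j"
  using boundary_vertex_inj[of i j] by (simp add: boundary_vertex_def)

lemma boundary_vertex_sink:
  "j \<in> {1..n} \<Longrightarrow> boundary_vertex n s t (2 * n + 1 - j) = t j"
  "j \<in> {1..n} \<Longrightarrow> 2 * n + 1 - j \<in> {1..2 * n} \<and> n < 2 * n + 1 - j"
  by (auto simp: boundary_vertex_def)

lemma sink_neq: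
  assumes "i \<in> {1..n}" "j \<in> {1..n}" "i < j"
  shows "t i \<noteq> t j"
proof -
  have "boundary_vertex n s t (2 * n + 1 - j) \<noteq> boundary_vertex n s t (2 * n + 1 - i)"
    using boundary_vertex_sink(2)[OF assms(1)] boundary_vertex_sink(2)[OF assms(2)] assms
    by (intro boundary_vertex_inj) auto
  then show ?thesis
    unfolding boundary_vertex_sink(1)[OF assms(1)] boundary_vertex_sink(1)[OF assms(2)] by simp
qed

lemma source_neq_sink:
  assumes "i \<in> {1..n}" "j \<in> {1..n}"
  shows "s i \<noteq> t j"
proof -
  have "boundary_vertex n s t i \<noteq> boundary_vertex n s t (2 * n + 1 - j)"
    using boundary_vertex_sink(2)[OF assms(2)] assms(1) by (intro boundary_vertex_inj) auto
  then show ?thesis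
    unfolding boundary_vertex_sink(1)[OF assms(2)] using assms(1) by (simp add: boundary_vertex_def)
qed

lemma inj_on_source: "inj_on s {1..n}"
proof (rule inj_onI)
  show "i = j" if "i \<in> {1..n}" "j \<in> {1..n}" "s i = s j" for i j
    using source_neq[of i j] source_neq[of j i] that by (cases i j rule: linorder_cases) auto
qed

lemma inj_on_sink: "inj_on t {1..n}"
proof (rule inj_onI)
  show "i = j" if "i \<in> {1..n}" "j \<in> {1..n}" "t i = t j" for i j
    using sink_neq[of i j] sink_neq[of j i] that by (cases i j rule: linorder_cases) auto
qed

section \<open>Walks and their crossings\<close>

lemma closed_awalk_Nil:
  assumes "awalk u p u"
  shows "p = []"
  using assms closed_w_imp_cycle[of p] acyclic by (auto simp: closed_w_def)

text \<open>A repeated vertex would give a closed walk. Walks may therefore be cut and joined below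
  without checking that the result is simple.\<close>

lemma awalk_imp_apath:
  assumes "awalk u p v"
  shows "apath u p v"
proof (rule ccontr)
  assume "\<not> apath u p v"
  then have "\<not> distinct (awalk_verts u p)" using assms by (simp add: apath_def)
  then obtain r w where "0 < length r" "awalk w r w"
    using awalk_not_distinct_decomp[OF assms] by blast
  then show False using closed_awalk_Nil by blast
qed

lemma apath_iff_awalk: "apath u p v \<longleftrightarrow> awalk u p v"
  using awalk_imp_apath awalkI_apath by blast

text \<open>The empty walk is excluded because the union over its arcs is empty and contains no
  curve.\<close>

lemma awalk_curve:
  assumes emb: "disc_embedding D n s t \<phi> \<gamma>"
  assumes "awalk u p v" "p \<noteq> []"
  shows "\<exists>f. path f \<and> path_image f \<subseteq> (\<Union>e\<in>set p. path_image (\<gamma> e)) \<and> pathstart f = \<phi> u \<and> pathfinish f = \<phi> v"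
  using assms(3,2)
proof (induction p arbitrary: u rule: list_nonempty_induct)
  case (single e)
  then have e: "e \<in> arcs D" "tail D e = u" "head D e = v" by (auto simp: awalk_Cons_iff awalk_Nil_iff)
  have "path (\<gamma> e) \<and> pathstart (\<gamma> e) = \<phi> u \<and> pathfinish (\<gamma> e) = \<phi> v"
    using emb e by (auto simp: disc_embedding_def arc_imp_path)
  then show ?case by (intro exI[of _ "\<gamma> e"]) simp
next
  case (cons e p)
  then have e: "e \<in> arcs D" "tail D e = u" "awalk (head D e) p v" by (auto simp: awalk_Cons_iff)
  obtain f where f: "path f" "path_image f \<subseteq> (\<Union>e\<in>set p. path_image (\<gamma> e))"
    "pathstart f = \<phi> (head D e)" "pathfinish f = \<phi> v"
    using cons.IH[OF e(3)] by blast
  have g: "path (\<gamma> e)" "pathstart (\<gamma> e) = \<phi> u" "pathfinish (\<gamma> e) = \<phi> (head D e)"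
    using emb e by (auto simp: disc_embedding_def arc_imp_path)
  have "path_image (\<gamma> e +++ f) = path_image (\<gamma> e) \<union> path_image f"
    using f g by (simp add: path_image_join)
  then show ?case using f g by (intro exI[of _ "\<gamma> e +++ f"]) auto
qed

text \<open>The ends occur on the boundary in the order \<open>s i\<close>, \<open>s j\<close>,
  \<open>t a\<close>, \<open>t b\<close>, so they interlace and the curves meet. By the embedding, a
  common point lies on an arc used by both walks or is the image of a common end of two arcs; either
  way there is a common vertex.\<close>

lemma crossing:
  assumes "i \<in> {1..n}" "j \<in> {1..n}" "a \<in> {1..n}" "b \<in> {1..n}" "i < j" "b < a"
    and p: "awalk (s i) p (t a)" and q: "awalk (s j) q (t b)"
  shows "set (awalk_verts (s i) p) \<inter> set (awalk_verts (s j) q) \<noteq> {}"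
proof -
  obtain \<phi> \<gamma> where emb: "disc_embedding D n s t \<phi> \<gamma>" using embeddable by blast
  obtain \<theta> where \<theta>: "\<forall>k\<in>{1..2 * n}. \<phi> (boundary_vertex n s t k) = cis (\<theta> k)"
    "\<forall>k\<in>{1..2 * n}. \<forall>l\<in>{1..2 * n}. k < l \<longrightarrow> \<theta> l < \<theta> k \<and> \<theta> k - \<theta> l < 2 * pi"
    using embedding_angles[OF emb] .
  \<comment> \<open>Sinks are listed backwards, so \<open>b < a\<close> places \<open>t b\<close>
    after \<open>t a\<close>.\<close>
  define a' b' where "a' = 2 * n + 1 - a" and "b' = 2 * n + 1 - b"
  have idx: "i \<in> {1..2 * n}" "j \<in> {1..2 * n}" "a' \<in> {1..2 * n}" "b' \<in> {1..2 * n}" "i < j" "j < a'" "a' < b'" "i < b'"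
  proof -
    have "a' + a = 2 * n + 1" "b' + b = 2 * n + 1" using assms(3,4) by (simp_all add: a'_def b'_def)
    then show "i \<in> {1..2 * n}" "j \<in> {1..2 * n}" "a' \<in> {1..2 * n}" "b' \<in> {1..2 * n}" "i < j" "j < a'" "a' < b'" "i < b'"
      using assms(1-6) unfolding atLeastAtMost_iff by linarith+
  qed
  have bv: "boundary_vertex n s t i = s i" "boundary_vertex n s t j = s j"
    "boundary_vertex n s t a' = t a" "boundary_vertex n s t b' = t b"
    using assms(1,2) boundary_vertex_sink(1)[OF assms(3)] boundary_vertex_sink(1)[OF assms(4)]
    by (simp add: boundary_vertex_def, simp add: boundary_vertex_def, simp_all only: a'_def b'_def)
  have ends: "\<phi> (s i) = cis (\<theta> i)" "\<phi> (s j) = cis (\<theta> j)"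
    "\<phi> (t a) = cis (\<theta> a')" "\<phi> (t b) = cis (\<theta> b')"
    using \<theta>(1)[rule_format, OF idx(1)] \<theta>(1)[rule_format, OF idx(2)]
      \<theta>(1)[rule_format, OF idx(3)] \<theta>(1)[rule_format, OF idx(4)] by (simp_all only: bv)
  have ne: "p \<noteq> []" "q \<noteq> []"
    using p q source_neq_sink[OF assms(1,3)] source_neq_sink[OF assms(2,4)] awalk_empty_ends by metis+
  obtain f where f: "path f" "path_image f \<subseteq> (\<Union>e\<in>set p. path_image (\<gamma> e))"
    "pathstart f = \<phi> (s i)" "pathfinish f = \<phi> (t a)"
    using awalk_curve[OF emb p ne(1)] by blast
  obtain g where g: "path g" "path_image g \<subseteq> (\<Union>e\<in>set q. path_image (\<gamma> e))"
    "pathstart g = \<phi> (s j)" "pathfinish g = \<phi> (t b)"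
    using awalk_curve[OF emb q ne(2)] by blast
  have pD: "set p \<subseteq> arcs D" and qD: "set q \<subseteq> arcs D"
    using p q by (simp_all add: awalk_def)
  have disc: "path_image (\<gamma> e) \<subseteq> cball 0 1" if "e \<in> arcs D" for e
    using emb that by (auto simp: disc_embedding_def)
  have disj: "\<forall>e\<in>arcs D. \<forall>e'\<in>arcs D. e \<noteq> e' \<longrightarrow> path_image (\<gamma> e) \<inter> path_image (\<gamma> e') \<subseteq>
      \<phi> ` ({tail D e, head D e} \<inter> {tail D e', head D e'})"
    using emb unfolding disc_embedding_def by (elim conjE)
  have "path_image f \<inter> path_image g \<noteq> {}"
  proof (rule disc_paths_cross[OF f(1) g(1)])
    show "path_image f \<subseteq> cball 0 1"
      using pD disc by (intro order_trans[OF f(2)] UN_least) auto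
    show "path_image g \<subseteq> cball 0 1"
      using qD disc by (intro order_trans[OF g(2)] UN_least) auto
    show "pathstart f = cis (\<theta> i)" "pathfinish f = cis (\<theta> a')"
      "pathstart g = cis (\<theta> j)" "pathfinish g = cis (\<theta> b')"
      using f g ends by simp_all
    show "\<theta> j < \<theta> i" "\<theta> a' < \<theta> j" "\<theta> b' < \<theta> a'" "\<theta> i - \<theta> b' < 2 * pi"
      using \<theta>(2)[rule_format, OF idx(1,2,5)] \<theta>(2)[rule_format, OF idx(2,3,6)]
        \<theta>(2)[rule_format, OF idx(3,4,7)] \<theta>(2)[rule_format, OF idx(1,4,8)] by blast+
  qed
  then obtain z where "z \<in> path_image f" "z \<in> path_image g" by blast
  then have "z \<in> (\<Union>e\<in>set p. path_image (\<gamma> e))" "z \<in> (\<Union>e\<in>set q. path_image (\<gamma> e))"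
    using f(2) g(2) subsetD by metis+
  then obtain e e' where e: "e \<in> set p" "z \<in> path_image (\<gamma> e)" "e' \<in> set q" "z \<in> path_image (\<gamma> e')"
    by (elim UN_E)
  have vp: "{tail D e, head D e} \<subseteq> set (awalk_verts (s i) p)"
    using set_awalk_verts[OF p] e(1) by auto
  have vq: "{tail D e', head D e'} \<subseteq> set (awalk_verts (s j) q)"
    using set_awalk_verts[OF q] e(3) by auto
  show ?thesis
  proof (cases "e = e'")
    case True
    then show ?thesis using vp vq by auto
  next
    case False
    then have "path_image (\<gamma> e) \<inter> path_image (\<gamma> e') \<subseteq> \<phi> ` ({tail D e, head D e} \<inter> {tail D e', head D e'})"
      using disj e(1,3) pD qD by (meson subsetD)
    then have "\<phi> ` ({tail D e, head D e} \<inter> {tail D e', head D e'}) \<noteq> {}" using e(2,4) by auto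
    then have "{tail D e, head D e} \<inter> {tail D e', head D e'} \<noteq> {}" by simp
    then show ?thesis using vp vq by blast
  qed
qed

section \<open>Exchanging tails at a common vertex\<close>

definition path_upto :: "'a \<Rightarrow> 'b list \<Rightarrow> 'b list" where
  "path_upto v = takeWhile (\<lambda>e. tail D e \<noteq> v)"

text \<open>The cut is at the first arc leaving \<open>v\<close>. If a walk ends in
  \<open>v\<close>, acyclicity leaves no such arc and this part is empty.\<close>

definition path_from :: "'a \<Rightarrow> 'b list \<Rightarrow> 'b list" where
  "path_from v = dropWhile (\<lambda>e. tail D e \<noteq> v)"

lemma path_upto_from [simp]: "path_upto v p @ path_from v p = p"
  by (simp add: path_upto_def path_from_def)

text \<open>An arc of \<open>q\<close> leaving \<open>v\<close> would start a closed walk at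
  \<open>v\<close>, so the cut recovers the two factors exactly. This is why swapping tails twice
  restores the family.\<close>

lemma path_upto_from_append:
  assumes q: "awalk u q v" and r: "awalk v r w"
  shows "path_upto v (q @ r) = q" "path_from v (q @ r) = r"
proof -
  have "tail D e \<noteq> v" if e: "e \<in> set q" for e
  proof
    assume v: "tail D e = v"
    obtain q1 q2 where "q = q1 @ e # q2" using split_list[OF e] by blast
    then have "awalk v (e # q2) v" using q v by (auto simp: awalk_Cons_iff)
    then show False using closed_awalk_Nil by blast
  qed
  moreover have "r = [] \<or> tail D (hd r) = v" using r by (cases r) (auto simp: awalk_Cons_iff)
  ultimately show "path_upto v (q @ r) = q" "path_from v (q @ r) = r"
    by (cases r; simp add: path_upto_def path_from_def)+
qed

lemma awalk_path_upto_from: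
  assumes "awalk u p w" "v \<in> set (awalk_verts u p)"
  shows "awalk u (path_upto v p) v" "awalk v (path_from v p) w"
proof -
  obtain q r where qr: "p = q @ r" "awalk u q v" "awalk v r w" using awalk_decomp[OF assms] by blast
  then show "awalk u (path_upto v p) v" "awalk v (path_from v p) w"
    using path_upto_from_append[OF qr(2,3)] by simp_all
qed

text \<open>A second common vertex would give a closed walk through \<open>v\<close>.\<close>

lemma awalk_verts_disjoint:
  assumes "awalk u q v" "awalk v r w" "x \<in> set (awalk_verts u q)" "x \<in> set (awalk_verts v r)"
  shows "x = v"
proof -
  have "awalk x (path_from x q) v" "awalk v (path_upto x r) x" using awalk_path_upto_from assms by blast+
  then have "awalk x (path_from x q @ path_upto x r) x" by (rule awalk_appendI)
  then have "path_from x q = []" using closed_awalk_Nil by blast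
  then show ?thesis using \<open>awalk x (path_from x q) v\<close> by (simp add: awalk_Nil_iff)
qed

lemma end_in_awalk_verts: "awalk u p v \<Longrightarrow> v \<in> set (awalk_verts u p)"
  by (metis awalkE awalk_verts_non_Nil last_in_set)

definition swap_tails :: "'a \<Rightarrow> nat \<Rightarrow> nat \<Rightarrow> (nat \<Rightarrow> 'b list) \<Rightarrow> nat \<Rightarrow> 'b list" where
  "swap_tails v i j \<pi> = \<pi>(i := path_upto v (\<pi> i) @ path_from v (\<pi> j), j := path_upto v (\<pi> j) @ path_from v (\<pi> i))"

definition visitors :: "nat set \<Rightarrow> (nat \<Rightarrow> 'b list) \<Rightarrow> 'a \<Rightarrow> nat set" where
  "visitors B \<pi> x = {i \<in> B. x \<in> set (awalk_verts (s i) (\<pi> i))}"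

definition shared :: "nat set \<Rightarrow> (nat \<Rightarrow> 'b list) \<Rightarrow> 'a set" where
  "shared B \<pi> = {x. \<exists>i\<in>visitors B \<pi> x. \<exists>j\<in>visitors B \<pi> x. i \<noteq> j}"

context
  fixes B :: "nat set" and \<pi> :: "nat \<Rightarrow> 'b list" and w :: "nat \<Rightarrow> nat" and v :: 'a and i j :: nat
  assumes \<pi>: "\<And>k. k \<in> B \<Longrightarrow> awalk (s k) (\<pi> k) (t (w k))"
    and ij: "i \<in> visitors B \<pi> v" "j \<in> visitors B \<pi> v" "i \<noteq> j"
begin

lemma swap_parts:
  "awalk (s i) (path_upto v (\<pi> i)) v" "awalk v (path_from v (\<pi> i)) (t (w i))"
  "awalk (s j) (path_upto v (\<pi> j)) v" "awalk v (path_from v (\<pi> j)) (t (w j))"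
  using awalk_path_upto_from[OF \<pi>] ij by (auto simp: visitors_def)

lemma swap_tails_awalk:
  assumes "k \<in> B"
  shows "awalk (s k) (swap_tails v i j \<pi> k) (t ((w \<circ> Transposition.transpose i j) k))"
  using \<pi>[OF assms] awalk_appendI[OF swap_parts(1,4)] awalk_appendI[OF swap_parts(3,2)] ij(3)
  by (auto simp: swap_tails_def Transposition.transpose_def)

lemma swap_tails_swap_tails: "swap_tails v i j (swap_tails v i j \<pi>) = \<pi>"
  using path_upto_from_append[OF swap_parts(1,4)] path_upto_from_append[OF swap_parts(3,2)] ij(3)
  by (auto simp: swap_tails_def fun_eq_iff)

lemma awalk_verts_swap_tails:
  "set (awalk_verts (s i) (swap_tails v i j \<pi> i)) =
    set (awalk_verts (s i) (path_upto v (\<pi> i))) \<union> set (awalk_verts v (path_from v (\<pi> j)))"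
  "set (awalk_verts (s j) (swap_tails v i j \<pi> j)) =
    set (awalk_verts (s j) (path_upto v (\<pi> j))) \<union> set (awalk_verts v (path_from v (\<pi> i)))"
  using set_awalk_verts_append[OF swap_parts(1,4)] set_awalk_verts_append[OF swap_parts(3,2)] ij(3)
  by (simp_all add: swap_tails_def)

lemma awalk_verts_parts:
  "set (awalk_verts (s i) (\<pi> i)) =
    set (awalk_verts (s i) (path_upto v (\<pi> i))) \<union> set (awalk_verts v (path_from v (\<pi> i)))"
  "set (awalk_verts (s j) (\<pi> j)) =
    set (awalk_verts (s j) (path_upto v (\<pi> j))) \<union> set (awalk_verts v (path_from v (\<pi> j)))"
  using set_awalk_verts_append[OF swap_parts(1,2)] set_awalk_verts_append[OF swap_parts(3,4)] by simp_all

lemma swap_tails_other: "k \<noteq> i \<Longrightarrow> k \<noteq> j \<Longrightarrow> swap_tails v i j \<pi> k = \<pi> k"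
  by (simp add: swap_tails_def)

lemma visitors_swap_tails: "visitors B (swap_tails v i j \<pi>) v = visitors B \<pi> v"
proof -
  have "v \<in> set (awalk_verts (s i) (swap_tails v i j \<pi> i))" "v \<in> set (awalk_verts (s j) (swap_tails v i j \<pi> j))"
    unfolding awalk_verts_swap_tails using swap_parts end_in_awalk_verts by blast+
  then have "v \<in> set (awalk_verts (s k) (swap_tails v i j \<pi> k)) \<longleftrightarrow> v \<in> set (awalk_verts (s k) (\<pi> k))"
    if "k \<in> B" for k
    using that ij swap_tails_other[of k] by (cases "k = i \<or> k = j") (auto simp: visitors_def)
  then show ?thesis by (auto simp: visitors_def)
qed

text \<open>Only this inclusion needs an argument; applied to the swapped family it gives the
  converse, since the swap is its own inverse.\<close>

lemma shared_subset_swap_tails: "shared B \<pi> \<subseteq> shared B (swap_tails v i j \<pi>)"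
proof
  fix x assume "x \<in> shared B \<pi>"
  then obtain k l where kl: "k \<in> visitors B \<pi> x" "l \<in> visitors B \<pi> x" "k \<noteq> l" by (auto simp: shared_def)
  let ?\<pi>' = "swap_tails v i j \<pi>"
  have iB: "i \<in> B" "j \<in> B" using ij by (auto simp: visitors_def)
  show "x \<in> shared B ?\<pi>'"
  proof (cases "x = v")
    case True
    then show ?thesis using kl visitors_swap_tails by (auto simp: shared_def)
  next
    case False
    let ?P = "\<lambda>k. x \<in> set (awalk_verts (s k) (path_upto v (\<pi> k)))" and ?S = "\<lambda>k. x \<in> set (awalk_verts v (path_from v (\<pi> k)))"
    \<comment> \<open>A new path cannot visit \<open>x\<close> both before and after
      \<open>v\<close>. So if both old paths visit \<open>x\<close>, then \<open>x\<close> lies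
      before \<open>v\<close> on both or after \<open>v\<close> on both, and both new paths visit it
      too.\<close>
    have excl: "\<not> (?P i \<and> ?S j)" "\<not> (?P j \<and> ?S i)"
      using awalk_verts_disjoint[OF swap_parts(1,4)] awalk_verts_disjoint[OF swap_parts(3,2)] False by blast+
    have old: "i \<in> visitors B \<pi> x \<longleftrightarrow> ?P i \<or> ?S i" "j \<in> visitors B \<pi> x \<longleftrightarrow> ?P j \<or> ?S j"
      using iB by (simp_all add: visitors_def awalk_verts_parts)
    have new: "i \<in> visitors B ?\<pi>' x \<longleftrightarrow> ?P i \<or> ?S j" "j \<in> visitors B ?\<pi>' x \<longleftrightarrow> ?P j \<or> ?S i"
      using iB by (simp_all add: visitors_def awalk_verts_swap_tails)
    have other: "k \<in> visitors B ?\<pi>' x \<longleftrightarrow> k \<in> visitors B \<pi> x" if "k \<noteq> i" "k \<noteq> j" for k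
      using that by (simp add: visitors_def swap_tails_other)
    consider "i \<in> visitors B \<pi> x" "j \<in> visitors B \<pi> x"
      | m where "i \<in> visitors B \<pi> x \<or> j \<in> visitors B \<pi> x" "m \<in> visitors B \<pi> x" "m \<noteq> i" "m \<noteq> j"
      | "k \<noteq> i" "k \<noteq> j" "l \<noteq> i" "l \<noteq> j"
      using kl by metis
    then show ?thesis
    proof cases
      case 1
      then have "i \<in> visitors B ?\<pi>' x" "j \<in> visitors B ?\<pi>' x" using old new excl by blast+
      then show ?thesis using ij(3) by (auto simp: shared_def)
    next
      case 2
      then have "i \<in> visitors B ?\<pi>' x \<or> j \<in> visitors B ?\<pi>' x" "m \<in> visitors B ?\<pi>' x"
        using old new other by blast+
      then show ?thesis using 2 by (auto simp: shared_def)
    next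
      case 3
      then show ?thesis using kl other by (auto simp: shared_def)
    qed
  qed
qed

lemma prod_path_wgt_swap_tails:
  assumes "finite B"
  shows "(\<Prod>k\<in>B. path_wgt wgt (swap_tails v i j \<pi> k)) = (\<Prod>k\<in>B. path_wgt wgt (\<pi> k))"
proof -
  have iB: "i \<in> B" "j \<in> B - {i}" using ij by (auto simp: visitors_def)
  have split: "(\<Prod>k\<in>B. f k) = f i * f j * (\<Prod>k\<in>B - {i} - {j}. f k)" for f :: "nat \<Rightarrow> real"
    using prod.remove[OF assms iB(1), of f] prod.remove[OF _ iB(2), of f] assms by simp
  have app: "path_wgt wgt (p @ q) = path_wgt wgt p * path_wgt wgt q" for p q
    by (simp add: path_wgt_def)
  have parts: "path_wgt wgt (\<pi> k) = path_wgt wgt (path_upto v (\<pi> k)) * path_wgt wgt (path_from v (\<pi> k))" for k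
    by (metis app path_upto_from)
  have "(\<Prod>k\<in>B - {i} - {j}. path_wgt wgt (swap_tails v i j \<pi> k)) = (\<Prod>k\<in>B - {i} - {j}. path_wgt wgt (\<pi> k))"
    by (rule prod.cong) (auto simp: swap_tails_other)
  moreover have "path_wgt wgt (swap_tails v i j \<pi> i) * path_wgt wgt (swap_tails v i j \<pi> j) =
      path_wgt wgt (\<pi> i) * path_wgt wgt (\<pi> j)"
    unfolding parts[of i] parts[of j] using ij(3) by (simp add: swap_tails_def app)
  ultimately show ?thesis unfolding split[of "\<lambda>k. path_wgt wgt (swap_tails v i j \<pi> k)"]
      split[of "\<lambda>k. path_wgt wgt (\<pi> k)"] by simp
qed

end

lemma shared_swap_tails:
  assumes \<pi>: "\<And>k. k \<in> B \<Longrightarrow> awalk (s k) (\<pi> k) (t (w k))"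
    and ij: "i \<in> visitors B \<pi> v" "j \<in> visitors B \<pi> v" "i \<noteq> j"
  shows "shared B (swap_tails v i j \<pi>) = shared B \<pi>"
proof
  have ij': "i \<in> visitors B (swap_tails v i j \<pi>) v" "j \<in> visitors B (swap_tails v i j \<pi>) v"
    using visitors_swap_tails[OF \<pi> ij] ij by auto
  show "shared B (swap_tails v i j \<pi>) \<subseteq> shared B \<pi>"
    using shared_subset_swap_tails[OF swap_tails_awalk[OF \<pi> ij] ij' ij(3)]
    by (simp only: swap_tails_swap_tails[OF \<pi> ij])
  show "shared B \<pi> \<subseteq> shared B (swap_tails v i j \<pi>)"
    by (rule shared_subset_swap_tails[OF \<pi> ij])
qed

section \<open>The order on indices and the determinant of the path matrix\<close>

abbreviation paths :: "nat \<Rightarrow> nat \<Rightarrow> 'b list set" where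
  "paths i j \<equiv> {p. apath (s i) p (t j)}"

lemma path_matrix_eq: "path_matrix D s t wgt i j = (\<Sum>p\<in>paths i j. path_wgt wgt p)"
  by (simp add: path_matrix_def)

lemma prod_path_matrix:
  "finite B \<Longrightarrow> (\<Prod>i\<in>B. path_matrix D s t wgt i (w i)) =
    (\<Sum>\<pi>\<in>PiE B (\<lambda>i. paths i (w i)). \<Prod>i\<in>B. path_wgt wgt (\<pi> i))"
  unfolding path_matrix_eq by (rule prod_sum_PiE) (auto intro: apaths_finite)

text \<open>The order of \<open>P(\<pi>)\<close> transported to indices, so that it can be
  restricted to any block and satisfies the label condition required of \<open>lt\<close>.\<close>

definition family_order :: "(nat \<Rightarrow> 'b list) \<Rightarrow> nat \<Rightarrow> nat \<Rightarrow> bool" where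
  "family_order \<pi> i j \<longleftrightarrow> i < j \<and> \<not> paths_intersect D s \<pi> i j"

lemma family_order_less: "family_order \<pi> i j \<Longrightarrow> i < j"
  by (simp add: family_order_def)

lemma paths_intersect_iff:
  "i \<in> B \<Longrightarrow> j \<in> B \<Longrightarrow> paths_intersect D s \<pi> i j \<longleftrightarrow> (\<exists>x. i \<in> visitors B \<pi> x \<and> j \<in> visitors B \<pi> x)"
  by (auto simp: paths_intersect_def visitors_def)

lemma sharedI: "i \<in> visitors B \<pi> x \<Longrightarrow> j \<in> visitors B \<pi> x \<Longrightarrow> i \<noteq> j \<Longrightarrow> x \<in> shared B \<pi>"
  unfolding shared_def by blast

lemma chain_on_family_order: "chain_on (family_order \<pi>) B \<longleftrightarrow> shared B \<pi> = {}"
proof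
  assume c: "chain_on (family_order \<pi>) B"
  have False if x: "x \<in> shared B \<pi>" for x
  proof -
    obtain k l where "k \<in> visitors B \<pi> x" "l \<in> visitors B \<pi> x" "k \<noteq> l"
      using x unfolding shared_def by blast
    then obtain i j where ij: "i \<in> visitors B \<pi> x" "j \<in> visitors B \<pi> x" "i < j"
      by (metis linorder_neqE_nat)
    then have "i \<in> B" "j \<in> B" by (auto simp: visitors_def)
    then show False using c ij paths_intersect_iff[of i B j \<pi>] by (auto simp: chain_on_def family_order_def)
  qed
  then show "shared B \<pi> = {}" by blast
next
  assume e: "shared B \<pi> = {}"
  show "chain_on (family_order \<pi>) B"
    unfolding chain_on_def family_order_def
  proof (intro ballI impI conjI notI)
    fix i j assume ij: "i \<in> B" "j \<in> B" "i < j" "paths_intersect D s \<pi> i j"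
    then obtain x where "i \<in> visitors B \<pi> x" "j \<in> visitors B \<pi> x" using paths_intersect_iff by blast
    then have "x \<in> shared B \<pi>" using ij(3) sharedI by blast
    then show False using e by simp
  qed
qed

text \<open>If the outer two of three paths meet, following the first and then the third gives a path
  which the middle one has to cross.\<close>

lemma family_order_trans:
  assumes "i \<in> {1..n}" "j \<in> {1..n}" "k \<in> {1..n}"
    and \<pi>: "\<And>l. l \<in> {i, j, k} \<Longrightarrow> awalk (s l) (\<pi> l) (t l)"
    and ord: "family_order \<pi> i j" "family_order \<pi> j k"
  shows "family_order \<pi> i k"
proof (rule ccontr)
  have lt: "i < j" "j < k" using ord by (auto simp: family_order_def)
  assume "\<not> family_order \<pi> i k"
  then have "paths_intersect D s \<pi> i k" using lt by (simp add: family_order_def)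
  then obtain x where x: "x \<in> set (awalk_verts (s i) (\<pi> i))" "x \<in> set (awalk_verts (s k) (\<pi> k))"
    by (auto simp: paths_intersect_def)
  have p: "awalk (s i) (path_upto x (\<pi> i)) x" "awalk x (path_from x (\<pi> i)) (t i)"
    and q: "awalk (s k) (path_upto x (\<pi> k)) x" "awalk x (path_from x (\<pi> k)) (t k)"
    using awalk_path_upto_from[OF \<pi>[of i] x(1)] awalk_path_upto_from[OF \<pi>[of k] x(2)] by simp_all
  have "set (awalk_verts (s i) (path_upto x (\<pi> i) @ path_from x (\<pi> k))) \<inter> set (awalk_verts (s j) (\<pi> j)) \<noteq> {}"
    by (rule crossing[OF assms(1,2,3,2) lt(1,2) awalk_appendI[OF p(1) q(2)]]) (simp add: \<pi>)
  moreover have "set (awalk_verts (s i) (path_upto x (\<pi> i) @ path_from x (\<pi> k))) \<subseteq>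
      set (awalk_verts (s i) (\<pi> i)) \<union> set (awalk_verts (s k) (\<pi> k))"
    using set_awalk_verts_append[OF p(1) q(2)] set_awalk_verts_append[OF p]
      set_awalk_verts_append[OF q] by auto
  ultimately have "paths_intersect D s \<pi> i j \<or> paths_intersect D s \<pi> j k"
    unfolding paths_intersect_def by blast
  then show False using ord by (auto simp: family_order_def)
qed

text \<open>The least moved index \<open>i\<close> has its image and its preimage \<open>j\<close>
  above it. The paths from \<open>s i\<close> to \<open>t (w i)\<close> and from \<open>s j\<close>
  to \<open>t i\<close> then have interlaced ends and cross.\<close>

lemma nonintersecting_imp_id:
  assumes "finite B" "B \<subseteq> {1..n}" "w permutes B"
    and \<pi>: "\<And>k. k \<in> B \<Longrightarrow> awalk (s k) (\<pi> k) (t (w k))"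
    and "shared B \<pi> = {}"
  shows "w = id"
proof (rule ccontr)
  assume "w \<noteq> id"
  then have ex: "\<exists>k. w k \<noteq> k" by auto
  define i where "i = (LEAST k. w k \<noteq> k)"
  have i: "w i \<noteq> i" unfolding i_def by (rule LeastI_ex[OF ex])
  have below: "w k = k" if "k < i" for k using that not_less_Least unfolding i_def by blast
  have inj: "inj w" using permutes_inj[OF assms(3)] .
  obtain j where j: "w j = i" using permutes_surj[OF assms(3)] by (metis surjD)
  have iB: "i \<in> B" using i permutes_not_in[OF assms(3)] by blast
  have wiB: "w i \<in> B" using iB permutes_in_image[OF assms(3)] by simp
  have jB: "j \<in> B" using j iB permutes_in_image[OF assms(3), of j] by simp
  have "\<not> w i < i" using below[of "w i"] injD[OF inj, of "w i" i] i by auto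
  then have wi: "i < w i" using i by simp
  have "\<not> j < i" using below[of j] j by auto
  then have ij: "i < j" using j i by (cases "i = j") auto
  have "set (awalk_verts (s i) (\<pi> i)) \<inter> set (awalk_verts (s j) (\<pi> j)) \<noteq> {}"
    using assms(2) iB jB wiB ij wi \<pi>[OF iB] \<pi>[OF jB] unfolding j
    by (intro crossing[of i j "w i" i]) auto
  then obtain x where "i \<in> visitors B \<pi> x" "j \<in> visitors B \<pi> x"
    using iB jB by (auto simp: visitors_def)
  then have "x \<in> shared B \<pi>" using ij sharedI by blast
  then show False using assms(5) by simp
qed

text \<open>Swapping the tails of two paths at a common vertex does not change the set of shared vertices,
  so an arbitrary fixed choice of a vertex in this set makes the swap an involution.\<close>

lemma lindstrom_gessel_viennot:
  assumes "finite B" "B \<subseteq> {1..n}"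
  shows "det_on (path_matrix D s t wgt) B =
    (\<Sum>\<pi>\<in>PiE B (\<lambda>i. paths i i). (\<Prod>i\<in>B. path_wgt wgt (\<pi> i)) * of_bool (chain_on (family_order \<pi>) B))"
proof -
  define W where "W = {w. w permutes B}"
  define F where "F w = PiE B (\<lambda>i. paths i (w i))" for w :: "nat \<Rightarrow> nat"
  define c where "c \<pi> = (\<Prod>i\<in>B. path_wgt wgt (\<pi> i))" for \<pi>
  define S where "S = Sigma W F"
  define h where "h = (\<lambda>(w :: nat \<Rightarrow> nat, \<pi>). real_of_int (sign w) * c \<pi>)"
  have finW: "finite W" unfolding W_def using assms(1) by (rule finite_permutations)
  have finF: "finite (F w)" for w
    unfolding F_def using assms(1) apaths_finite by (intro finite_PiE) auto
  have finS: "finite S" unfolding S_def using finW finF by (rule finite_SigmaI)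
  have "det_on (path_matrix D s t wgt) B = (\<Sum>w\<in>W. \<Sum>\<pi>\<in>F w. h (w, \<pi>))"
    unfolding det_on_def prod_path_matrix[OF assms(1)] W_def F_def h_def c_def
    by (simp add: sum_distrib_left)
  also have "\<dots> = sum h S"
    unfolding S_def using finW finF by (simp add: sum.Sigma)
  finally have det: "det_on (path_matrix D s t wgt) B = sum h S" .
  define bad where "bad = {(w, \<pi>) \<in> S. shared B \<pi> \<noteq> {}}"
  define good where "good = {(w, \<pi>) \<in> S. shared B \<pi> = {}}"
  have walk: "awalk (s k) (\<pi> k) (t (w k))" if "(w, \<pi>) \<in> S" "k \<in> B" for w \<pi> k
    using that unfolding S_def F_def apath_iff_awalk[symmetric] by (auto simp: PiE_iff)
  \<comment> \<open>The vertex depends on \<open>\<pi>\<close> only through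
    \<open>shared B \<pi>\<close>, and the two indices only through the visitors of that vertex.
    Both sets survive the swap, so the same vertex and indices are chosen again.\<close>
  define vtx where "vtx \<pi> = (SOME x. x \<in> shared B \<pi>)" for \<pi>
  define fst_i where "fst_i \<pi> = Min (visitors B \<pi> (vtx \<pi>))" for \<pi>
  define snd_i where "snd_i \<pi> = Min (visitors B \<pi> (vtx \<pi>) - {fst_i \<pi>})" for \<pi>
  define \<Phi> where "\<Phi> = (\<lambda>(w :: nat \<Rightarrow> nat, \<pi>). (w \<circ> Transposition.transpose (fst_i \<pi>) (snd_i \<pi>),
      swap_tails (vtx \<pi>) (fst_i \<pi>) (snd_i \<pi>) \<pi>))"
  have \<Phi>: "\<Phi> p \<in> bad \<and> \<Phi> (\<Phi> p) = p \<and> h (\<Phi> p) = - h p" if p: "p \<in> bad" for p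
  proof -
    obtain w \<pi> where p_eq: "p = (w, \<pi>)" by (cases p)
    have S: "(w, \<pi>) \<in> S" and sh: "shared B \<pi> \<noteq> {}" using p by (auto simp: bad_def p_eq)
    then have wB: "w permutes B" and \<pi>F: "\<pi> \<in> F w" by (auto simp: S_def W_def)
    define v where "v = vtx \<pi>"
    define i where "i = fst_i \<pi>"
    define j where "j = snd_i \<pi>"
    let ?V = "visitors B \<pi> v"
    have "v \<in> shared B \<pi>" unfolding v_def vtx_def using sh by (simp add: some_in_eq)
    then obtain k l where kl: "k \<in> ?V" "l \<in> ?V" "k \<noteq> l" by (auto simp: shared_def)
    have finV: "finite ?V" using assms(1) by (simp add: visitors_def)
    have i: "i \<in> ?V" unfolding i_def fst_i_def v_def[symmetric] using finV kl by (intro Min_in) auto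
    have "?V - {i} \<noteq> {}" using kl by blast
    then have "j \<in> ?V - {i}"
      unfolding j_def snd_i_def v_def[symmetric] i_def[symmetric] using finV by (intro Min_in) auto
    then have j: "j \<in> ?V" "i \<noteq> j" by auto
    have iB: "i \<in> B" "j \<in> B" using i j by (auto simp: visitors_def)
    note swap = walk[OF S] i j
    let ?\<pi> = "swap_tails v i j \<pi>" and ?\<tau> = "Transposition.transpose i j"
    have eq: "\<Phi> p = (w \<circ> ?\<tau>, ?\<pi>)" by (simp add: \<Phi>_def p_eq v_def i_def j_def)
    have sh': "shared B ?\<pi> = shared B \<pi>" by (rule shared_swap_tails[OF swap])
    have v': "vtx ?\<pi> = v" unfolding vtx_def sh' by (simp add: v_def vtx_def)
    have V': "visitors B ?\<pi> v = ?V" by (rule visitors_swap_tails[OF swap])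
    have i': "fst_i ?\<pi> = i" unfolding fst_i_def v' V' by (simp add: i_def fst_i_def v_def)
    have j': "snd_i ?\<pi> = j" unfolding snd_i_def v' V' i' by (simp add: j_def snd_i_def v_def i_def)
    have "w \<circ> ?\<tau> permutes B" using wB iB by (intro permutes_compose permutes_swap_id)
    moreover have "?\<pi> \<in> F (w \<circ> ?\<tau>)"
    proof -
      have "?\<pi> k = undefined" if "k \<notin> B" for k
        using that \<pi>F iB by (auto simp: F_def swap_tails_def PiE_iff extensional_def)
      then show ?thesis
        unfolding F_def PiE_iff extensional_def apath_iff_awalk using swap_tails_awalk[OF swap] by simp
    qed
    ultimately have "\<Phi> p \<in> bad" using sh sh' by (simp add: bad_def S_def W_def eq)
    moreover have "\<Phi> (\<Phi> p) = p"
      unfolding eq using swap_tails_swap_tails[OF swap]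
      by (simp add: \<Phi>_def v' i' j' p_eq comp_assoc)
    moreover have "h (\<Phi> p) = - h p"
    proof -
      have "permutation w" using wB assms(1) permutation_permutes by blast
      then have "sign (w \<circ> ?\<tau>) = - sign w"
        using j(2) by (simp add: sign_compose permutation_swap_id sign_swap_id)
      moreover have "c ?\<pi> = c \<pi>" unfolding c_def by (rule prod_path_wgt_swap_tails[OF swap assms(1)])
      ultimately show ?thesis unfolding eq by (simp add: h_def p_eq)
    qed
    ultimately show ?thesis by blast
  qed
  have "sum h bad = (\<Sum>p\<in>bad. h (\<Phi> p))"
    by (rule sum.reindex_bij_witness[where i = \<Phi> and j = \<Phi>]) (use \<Phi> in auto)
  also have "\<dots> = - sum h bad" using \<Phi> by (simp add: sum_negf)
  finally have bad0: "sum h bad = 0" by simp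
  have "S = bad \<union> good" "bad \<inter> good = {}" by (auto simp: bad_def good_def)
  then have "sum h S = sum h good"
    using finS bad0 sum.union_disjoint[of bad good h] by (metis add_0 finite_Un)
  also have "\<dots> = (\<Sum>\<pi> | \<pi> \<in> F id \<and> shared B \<pi> = {}. c \<pi>)"
  proof (rule sum.reindex_bij_witness[where i = "\<lambda>\<pi>. (id, \<pi>)" and j = snd])
    fix p assume p: "p \<in> good"
    obtain w \<pi> where p_eq: "p = (w, \<pi>)" by (cases p)
    have S: "(w, \<pi>) \<in> S" and sh: "shared B \<pi> = {}" using p by (auto simp: good_def p_eq)
    have w: "w = id"
      using S sh by (intro nonintersecting_imp_id[OF assms _ walk[OF S]]) (auto simp: S_def W_def)
    show "(id, snd p) = p" "c (snd p) = h p" by (simp_all add: p_eq w h_def sign_id)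
    show "snd p \<in> {\<pi> \<in> F id. shared B \<pi> = {}}" using S sh by (simp add: p_eq S_def w)
  next
    fix \<pi> assume "\<pi> \<in> {\<pi> \<in> F id. shared B \<pi> = {}}"
    then show "(id, \<pi>) \<in> good" by (simp add: good_def S_def W_def permutes_id)
  qed simp
  also have "\<dots> = (\<Sum>\<pi>\<in>F id. c \<pi> * of_bool (shared B \<pi> = {}))"
    using finF[of id] by (simp add: sum.inter_filter of_bool_def if_distrib cong: if_cong)
  finally show ?thesis
    unfolding det by (simp add: c_def F_def chain_on_family_order)
qed

end

section \<open>The three expansions\<close>

lemma descent_free_words_cong:
  assumes "\<And>x y. x \<in> I \<Longrightarrow> y \<in> I \<Longrightarrow> lt x y = lt' x y"
  shows "descent_free_words lt I = descent_free_words lt' I"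
proof -
  have "successively (\<lambda>x y. \<not> lt y x) r \<longleftrightarrow> successively (\<lambda>x y. \<not> lt' y x) r" if "set r = I" for r
    using that assms by (intro successively_cong) auto
  then show ?thesis unfolding descent_free_words_def by blast
qed

lemma descent_free_iff:
  "descent_free lt U \<longleftrightarrow> (\<forall>r\<in>set U. successively (\<lambda>x y. \<not> lt y x) r)"
  by (auto simp: descent_free_def successively_conv_nth all_set_conv_all_nth)

lemma excedance_free_iff:
  "excedance_free lt lab U \<longleftrightarrow> (\<forall>r\<in>set U. \<forall>j<length r. \<not> lt (sort_key lab r ! j) (r ! j))"
  by (auto simp: excedance_free_def row_sorted_def all_set_conv_all_nth)

context planar_network
begin

lemma family_order_cong:
  assumes "\<pi> i = \<pi>' i" "\<pi> j = \<pi>' j"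
  shows "family_order \<pi> i j = family_order \<pi>' i j"
  using assms by (simp add: family_order_def paths_intersect_def)

lemma awalk_family:
  assumes "\<pi> \<in> PiE B (\<lambda>i. paths i (w i))" "k \<in> B"
  shows "awalk (s k) (\<pi> k) (t (w k))"
proof -
  have "\<pi> k \<in> paths k (w k)" using assms by (rule PiE_mem)
  then show ?thesis by (simp add: apath_iff_awalk)
qed

lemma family_order_trans_id:
  assumes "\<pi> \<in> PiE B (\<lambda>i. paths i i)" "B \<subseteq> {1..n}" "x \<in> B" "y \<in> B" "z \<in> B"
    and "family_order \<pi> x y" "family_order \<pi> y z"
  shows "family_order \<pi> x z"
proof (rule family_order_trans[OF _ _ _ _ assms(6,7)])
  show "x \<in> {1..n}" "y \<in> {1..n}" "z \<in> {1..n}" using assms by auto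
  show "awalk (s k) (\<pi> k) (t k)" if "k \<in> {x, y, z}" for k
    using that assms by (intro awalk_family[of \<pi> B "\<lambda>i. i"]) auto
qed

text \<open>Gluing families on \<open>B\<close> and \<open>I - B\<close> turns each product in the
  recursion into a sum over families on \<open>I\<close>. For a fixed family the remaining
  alternating sum vanishes by \<open>descent_free_recursion\<close> for its own order.\<close>

lemma perm_on_path_matrix:
  assumes "X \<subseteq> {1..n}"
  shows "perm_on (path_matrix D s t wgt) X =
    (\<Sum>\<pi>\<in>PiE X (\<lambda>i. paths i i). (\<Prod>i\<in>X. path_wgt wgt (\<pi> i)) *
      real (card (descent_free_words (family_order \<pi>) X)))"
proof (rule signed_convolution_unique[where e = "det_on (path_matrix D s t wgt)"])
  show "finite X" using assms by (rule finite_subset) simp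
  have "descent_free_words lt {} = {[]}" for lt by (auto simp: descent_free_words_def)
  then show "perm_on (path_matrix D s t wgt) {} =
    (\<Sum>\<pi>\<in>PiE {} (\<lambda>i. paths i i). (\<Prod>i\<in>{}. path_wgt wgt (\<pi> i)) *
      real (card (descent_free_words (family_order \<pi>) {})))" by simp
  show "det_on (path_matrix D s t wgt) {} = 1" by simp
next
  fix I assume I: "I \<subseteq> X" "I \<noteq> {}"
  have In: "I \<subseteq> {1..n}" using I assms by blast
  have fin: "finite I" using In by (rule finite_subset) simp
  show "(\<Sum>B\<in>Pow I. (-1) ^ card B * det_on (path_matrix D s t wgt) B *
      perm_on (path_matrix D s t wgt) (I - B)) = 0"
    using muir_identity[OF fin I(2)] .
  let ?F = "\<lambda>i. paths i i"
  let ?c = "\<lambda>B \<pi>. \<Prod>i\<in>B. path_wgt wgt (\<pi> i)"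
  let ?d = "\<lambda>\<pi> B. real (card (descent_free_words (family_order \<pi>) B))"
  let ?ch = "\<lambda>\<pi> B. of_bool (chain_on (family_order \<pi>) B) :: real"
  have conv: "det_on (path_matrix D s t wgt) B * (\<Sum>\<pi>\<in>PiE (I - B) ?F. ?c (I - B) \<pi> * ?d \<pi> (I - B)) =
      (\<Sum>\<pi>\<in>PiE I ?F. ?c I \<pi> * (?ch \<pi> B * ?d \<pi> (I - B)))" if B: "B \<subseteq> I" for B
  proof -
    have Bn: "finite B" "B \<subseteq> {1..n}" using B fin In finite_subset by auto
    let ?m = "\<lambda>\<rho> \<sigma> i. if i \<in> B then \<rho> i else \<sigma> i"
    \<comment> \<open>Chains in \<open>B\<close> depend only on the paths indexed by
      \<open>B\<close>, and words on \<open>I - B\<close> only on the others, so each factor sees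
      one part of the glued family.\<close>
    have ch: "?ch (?m \<rho> \<sigma>) B = ?ch \<rho> B" for \<rho> \<sigma>
    proof -
      have "chain_on (family_order (?m \<rho> \<sigma>)) B = chain_on (family_order \<rho>) B"
        unfolding chain_on_def by (intro ball_cong refl imp_cong family_order_cong) auto
      then show ?thesis by simp
    qed
    have d: "?d (?m \<rho> \<sigma>) (I - B) = ?d \<sigma> (I - B)" for \<rho> \<sigma>
    proof -
      have "descent_free_words (family_order (?m \<rho> \<sigma>)) (I - B) = descent_free_words (family_order \<sigma>) (I - B)"
        by (rule descent_free_words_cong, rule family_order_cong) simp_all
      then show ?thesis by simp
    qed
    have "(\<Sum>\<pi>\<in>PiE I ?F. ?c I \<pi> * (?ch \<pi> B * ?d \<pi> (I - B))) =
        (\<Sum>\<rho>\<in>PiE B ?F. \<Sum>\<sigma>\<in>PiE (I - B) ?F. (?c B \<rho> * ?ch \<rho> B) * (?c (I - B) \<sigma> * ?d \<sigma> (I - B)))"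
      unfolding sum_PiE_split[OF B] ch d prod_if_split[OF fin B, of "\<lambda>i. path_wgt wgt"]
      by (simp only: mult_ac)
    also have "\<dots> = det_on (path_matrix D s t wgt) B * (\<Sum>\<pi>\<in>PiE (I - B) ?F. ?c (I - B) \<pi> * ?d \<pi> (I - B))"
      unfolding lindstrom_gessel_viennot[OF Bn] by (simp only: sum_product)
    finally show ?thesis by simp
  qed
  have "(\<Sum>B\<in>Pow I. (-1) ^ card B * det_on (path_matrix D s t wgt) B *
      (\<Sum>\<pi>\<in>PiE (I - B) ?F. ?c (I - B) \<pi> * ?d \<pi> (I - B))) =
      (\<Sum>B\<in>Pow I. \<Sum>\<pi>\<in>PiE I ?F. ?c I \<pi> * ((-1) ^ card B * ?ch \<pi> B * ?d \<pi> (I - B)))"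
  proof (rule sum.cong[OF refl])
    fix B assume "B \<in> Pow I"
    then have B: "B \<subseteq> I" by simp
    show "(-1) ^ card B * det_on (path_matrix D s t wgt) B *
        (\<Sum>\<pi>\<in>PiE (I - B) ?F. ?c (I - B) \<pi> * ?d \<pi> (I - B)) =
        (\<Sum>\<pi>\<in>PiE I ?F. ?c I \<pi> * ((-1) ^ card B * ?ch \<pi> B * ?d \<pi> (I - B)))"
      unfolding mult.assoc conv[OF B] unfolding sum_distrib_left by (simp only: mult.left_commute)
  qed
  also have "\<dots> = (\<Sum>\<pi>\<in>PiE I ?F. \<Sum>B\<in>Pow I. ?c I \<pi> * ((-1) ^ card B * ?ch \<pi> B * ?d \<pi> (I - B)))"
    by (rule sum.swap)
  also have "\<dots> = (\<Sum>\<pi>\<in>PiE I ?F. ?c I \<pi> * (\<Sum>B\<in>Pow I. (-1) ^ card B * ?ch \<pi> B * ?d \<pi> (I - B)))"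
    by (simp only: sum_distrib_left)
  also have "\<dots> = 0"
  proof (rule sum.neutral, rule ballI)
    fix \<pi> assume \<pi>: "\<pi> \<in> PiE I ?F"
    have "(\<Sum>B\<in>Pow I. (-1) ^ card B * ?ch \<pi> B * ?d \<pi> (I - B)) = 0"
      by (rule descent_free_recursion[OF fin I(2) family_order_less family_order_trans_id[OF \<pi> In]])
    then show "?c I \<pi> * (\<Sum>B\<in>Pow I. (-1) ^ card B * ?ch \<pi> B * ?d \<pi> (I - B)) = 0" by simp
  qed
  finally show "(\<Sum>B\<in>Pow I. (-1) ^ card B * det_on (path_matrix D s t wgt) B *
      (\<Sum>\<pi>\<in>PiE (I - B) ?F. ?c (I - B) \<pi> * ?d \<pi> (I - B))) = 0" .
qed

section \<open>From tableaux of paths to tableaux of indices\<close>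

lemma path_not_Nil:
  assumes "i \<in> {1..n}" "j \<in> {1..n}" "awalk (s i) p (t j)"
  shows "p \<noteq> []"
  using assms source_neq_sink awalk_empty_ends by metis

lemma source_index_path:
  assumes "i \<in> {1..n}" "j \<in> {1..n}" and p: "awalk (s i) p (t j)"
  shows "source_index D n s p = i"
proof -
  have "tail D (hd p) = s i"
    using path_not_Nil[OF assms] p by (cases p) (auto simp: awalk_Cons_iff)
  then show ?thesis
    unfolding source_index_def using assms(1) inj_onD[OF inj_on_source] by (intro the_equality) simp_all
qed

lemma sink_index_path:
  assumes "i \<in> {1..n}" "j \<in> {1..n}" and p: "awalk (s i) p (t j)"
  shows "sink_index D n t p = j"
proof -
  have "head D (last p) = t j"
    using path_not_Nil[OF assms] awlast_of_awalk[OF p] by (simp add: awalk_verts_conv)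
  then show ?thesis
    unfolding sink_index_def using assms(2) inj_onD[OF inj_on_sink] by (intro the_equality) simp_all
qed

lemma path_families_eq:
  "path_families D n s t = (\<Union>w\<in>{w. w permutes {1..n}}. PiE {1..n} (\<lambda>i. paths i (w i)))"
proof (rule Set.set_eqI)
  fix \<pi>
  show "\<pi> \<in> path_families D n s t \<longleftrightarrow> \<pi> \<in> (\<Union>w\<in>{w. w permutes {1..n}}. PiE {1..n} (\<lambda>i. paths i (w i)))"
    by (simp add: path_families_def has_type_def PiE_iff) metis
qed

lemma path_families_id_eq: "path_families_id D n s t = PiE {1..n} (\<lambda>i. paths i i)"
proof -
  have "PiE {1..n} (\<lambda>i. paths i i) \<subseteq> path_families D n s t"
    unfolding path_families_eq using permutes_id[of "{1..n}"] by (intro subsetI UN_I[of id]) simp_all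
  moreover have "has_type D n s t \<pi> id \<longleftrightarrow> \<pi> \<in> PiE {1..n} (\<lambda>i. paths i i)" if "\<pi> \<in> extensional {1..n}" for \<pi>
    using that by (simp add: has_type_def PiE_iff)
  moreover have "path_families D n s t \<subseteq> extensional {1..n}"
    by (simp add: path_families_def)
  ultimately show ?thesis
    unfolding path_families_id_def by blast
qed

text \<open>A path determines its source, hence its index. This allows paths and indices to be
  exchanged in tableaux.\<close>

lemma family_inj:
  assumes w: "w permutes {1..n}" and \<pi>: "\<pi> \<in> PiE {1..n} (\<lambda>i. paths i (w i))"
  shows "inj_on \<pi> {1..n}"
proof (rule inj_onI)
  fix i j assume "i \<in> {1..n}" "j \<in> {1..n}" "\<pi> i = \<pi> j"
  then show "i = j"
    using source_index_path[OF _ _ awalk_family[OF \<pi>]] permutes_in_image[OF w] by metis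
qed

text \<open>Distinct types have disjoint sets of path families, because sinks are distinct.\<close>

lemma sum_path_families:
  fixes f :: "(nat \<Rightarrow> 'b list) \<Rightarrow> real"
  shows "(\<Sum>\<pi>\<in>path_families D n s t. f \<pi>) =
    (\<Sum>w | w permutes {1..n}. \<Sum>\<pi>\<in>PiE {1..n} (\<lambda>i. paths i (w i)). f \<pi>)"
  unfolding path_families_eq
proof (rule sum.UNION_disjoint)
  show "finite {w. w permutes {1..n}}" by (simp add: finite_permutations)
  show "\<forall>w\<in>{w. w permutes {1..n}}. finite (PiE {1..n} (\<lambda>i. paths i (w i)))"
    by (auto intro!: finite_PiE apaths_finite)
  show "\<forall>w\<in>{w. w permutes {1..n}}. \<forall>w'\<in>{w. w permutes {1..n}}. w \<noteq> w' \<longrightarrow>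
      PiE {1..n} (\<lambda>i. paths i (w i)) \<inter> PiE {1..n} (\<lambda>i. paths i (w' i)) = {}"
  proof (intro ballI impI)
    fix w w' assume w: "w \<in> {w. w permutes {1..n}}" "w' \<in> {w. w permutes {1..n}}" "w \<noteq> w'"
    have False if \<pi>: "\<pi> \<in> PiE {1..n} (\<lambda>i. paths i (w i))" "\<pi> \<in> PiE {1..n} (\<lambda>i. paths i (w' i))" for \<pi>
    proof -
      have "w i = w' i" if i: "i \<in> {1..n}" for i
      proof -
        have "w i \<in> {1..n}" "w' i \<in> {1..n}" using w i permutes_in_image by (metis mem_Collect_eq)+
        then show ?thesis
          using sink_index_path[OF i _ awalk_family[OF \<pi>(1) i]] sink_index_path[OF i _ awalk_family[OF \<pi>(2) i]]
          by simp
      qed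
      moreover have "w i = w' i" if "i \<notin> {1..n}" for i
        using w that permutes_not_in by (metis mem_Collect_eq)
      ultimately have "w = w'" by blast
      then show False using w by simp
    qed
    then show "PiE {1..n} (\<lambda>i. paths i (w i)) \<inter> PiE {1..n} (\<lambda>i. paths i (w' i)) = {}" by blast
  qed
qed

text \<open>A row set \<open>I\<close> has one increasing filling, and it is row-closed iff
  \<open>w\<close> preserves \<open>I\<close>. The count thus depends only on the type and is the
  block sum of \<open>eta_char_eq_block_sum\<close>.\<close>

lemma card_row_closed_left_strict:
  assumes w: "w permutes {1..n}" and \<pi>: "\<pi> \<in> PiE {1..n} (\<lambda>i. paths i (w i))"
  shows "real (card {U \<in> tableaux lam (\<pi> ` {1..n}). row_closed D n s t U \<and> left_row_strict D n s U}) =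
    block_sum lam (\<lambda>I. of_bool (w ` I = I)) {1..n}"
proof -
  let ?Q = "\<lambda>r. mset (map w r) = mset r \<and> sorted_wrt (<) r"
  have eq: "row_closed D n s t (map (map \<pi>) V) \<and> left_row_strict D n s (map (map \<pi>) V) \<longleftrightarrow> (\<forall>r\<in>set V. ?Q r)"
    if V: "V \<in> tableaux lam {1..n}" for V
  proof -
    have rows: "i \<in> {1..n}" if "r \<in> set V" "i \<in> set r" for r i
      using V that by (auto simp: tableaux_def)
    have wi: "w i \<in> {1..n}" if "i \<in> {1..n}" for i using permutes_in_image[OF w] that by simp
    have src: "map (source_index D n s) (map \<pi> r) = r" if "r \<in> set V" for r
      using rows[OF that] source_index_path[OF _ wi awalk_family[OF \<pi>]] by (auto intro!: map_idI)
    have snk: "map (sink_index D n t) (map \<pi> r) = map w r" if "r \<in> set V" for r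
      using rows[OF that] sink_index_path[OF _ wi awalk_family[OF \<pi>]] by auto
    have "left_tableau D n s (map (map \<pi>) V) = V"
    proof -
      have "left_tableau D n s (map (map \<pi>) V) = map (\<lambda>r. map (source_index D n s) (map \<pi> r)) V"
        by (simp add: left_tableau_def o_def)
      also have "\<dots> = V" using src by (rule map_idI)
      finally show ?thesis .
    qed
    moreover have "right_tableau D n t (map (map \<pi>) V) = map (map w) V"
      unfolding right_tableau_def using snk by simp
    ultimately show ?thesis
      by (auto simp: row_closed_def left_row_strict_def all_set_conv_all_nth)
  qed
  have "card {U \<in> tableaux lam (\<pi> ` {1..n}). row_closed D n s t U \<and> left_row_strict D n s U} =
      card {V \<in> tableaux lam {1..n}. \<forall>r\<in>set V. ?Q r}"
    unfolding card_tableaux_image[OF family_inj[OF w \<pi>]] using eq by (metis (no_types, lifting))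
  then have "real (card {U \<in> tableaux lam (\<pi> ` {1..n}). row_closed D n s t U \<and> left_row_strict D n s U}) =
      block_sum lam (\<lambda>I. real (card {r. distinct r \<and> set r = I \<and> ?Q r})) {1..n}"
    using card_tableaux_rows[of "{1..n}" lam ?Q] by simp
  also have "\<dots> = block_sum lam (\<lambda>I. of_bool (w ` I = I)) {1..n}"
  proof (rule block_sum_cong)
    fix I assume "I \<subseteq> {1..n}"
    then have fin: "finite I" by (rule finite_subset) simp
    let ?r = "sorted_list_of_set I"
    have mset: "mset ?r = mset_set I" using fin by (simp add: mset_set_set[symmetric] flip: sorted_list_of_mset_set)
    have "mset (map w ?r) = mset ?r \<longleftrightarrow> w ` I = I"
    proof -
      have "mset (map w ?r) = mset_set (w ` I)"
        using mset image_mset_mset_set[of w I] permutes_inj_on[OF w] by simp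
      then show ?thesis using mset fin by (simp add: mset_set_eq_iff)
    qed
    moreover have "r = ?r" if "set r = I" "sorted_wrt (<) r" for r
      using that sorted_list_of_set_unique[OF fin, of r] by (metis distinct_card strict_sorted_iff)
    ultimately have "{r. distinct r \<and> set r = I \<and> ?Q r} = (if w ` I = I then {?r} else {})"
      using fin by auto
    then show "real (card {r. distinct r \<and> set r = I \<and> ?Q r}) = of_bool (w ` I = I)" by simp
  qed
  finally show ?thesis .
qed

lemma family_less_iff:
  assumes "inj_on \<pi> {1..n}" "i \<in> {1..n}" "j \<in> {1..n}"
  shows "family_less D n s \<pi> (\<pi> i) (\<pi> j) \<longleftrightarrow> family_order \<pi> i j"
  using assms unfolding family_less_def family_order_def by (metis inj_on_eq_iff)

lemma card_descent_free:
  assumes inj: "inj_on \<pi> {1..n}"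
  shows "real (card {U \<in> tableaux lam (\<pi> ` {1..n}). descent_free (family_less D n s \<pi>) U}) =
    block_sum lam (\<lambda>I. real (card (descent_free_words (family_order \<pi>) I))) {1..n}"
proof -
  let ?Q = "successively (\<lambda>x y. \<not> family_order \<pi> y x)"
  have "descent_free (family_less D n s \<pi>) (map (map \<pi>) V) \<longleftrightarrow> (\<forall>r\<in>set V. ?Q r)"
    if V: "V \<in> tableaux lam {1..n}" for V
  proof -
    have "successively (\<lambda>x y. \<not> family_less D n s \<pi> y x) (map \<pi> r) \<longleftrightarrow> ?Q r" if r: "r \<in> set V" for r
    proof -
      have "set r \<subseteq> {1..n}" using V r by (auto simp: tableaux_def)
      then have "(\<not> family_less D n s \<pi> (\<pi> y) (\<pi> x)) = (\<not> family_order \<pi> y x)"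
        if "x \<in> set r" "y \<in> set r" for x y
        using family_less_iff[OF inj, of y x] that by blast
      then show ?thesis unfolding successively_map by (intro successively_cong) auto
    qed
    then show ?thesis unfolding descent_free_iff by simp
  qed
  then have "card {U \<in> tableaux lam (\<pi> ` {1..n}). descent_free (family_less D n s \<pi>) U} =
      card {V \<in> tableaux lam {1..n}. \<forall>r\<in>set V. ?Q r}"
    unfolding card_tableaux_image[OF inj] by (metis (no_types, lifting))
  then show ?thesis
    using card_tableaux_rows[of "{1..n}" lam ?Q] by (simp add: descent_free_words_def)
qed

lemma card_excedance_free:
  assumes inj: "inj_on \<pi> {1..n}"
  shows "real (card {U \<in> tableaux lam (\<pi> ` {1..n}). excedance_free (family_less D n s \<pi>) (family_label n \<pi>) U}) =
    block_sum lam (\<lambda>I. real (card (excedance_free_words (family_order \<pi>) I))) {1..n}"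
proof -
  let ?Q = "\<lambda>r. \<forall>j<length r. \<not> family_order \<pi> (sort r ! j) (r ! j)"
  have "excedance_free (family_less D n s \<pi>) (family_label n \<pi>) (map (map \<pi>) V) \<longleftrightarrow> (\<forall>r\<in>set V. ?Q r)"
    if V: "V \<in> tableaux lam {1..n}" for V
  proof -
    have "(\<forall>j<length (map \<pi> r). \<not> family_less D n s \<pi> (sort_key (family_label n \<pi>) (map \<pi> r) ! j) (map \<pi> r ! j)) \<longleftrightarrow> ?Q r"
      if r: "r \<in> set V" for r
    proof -
      have r': "set r \<subseteq> {1..n}" using V r by (auto simp: tableaux_def)
      have lab: "family_label n \<pi> (\<pi> i) = i" if "i \<in> {1..n}" for i
        unfolding family_label_def using inj that by (rule inv_into_f_f)
      \<comment> \<open>Besides sortedness, \<open>properties_for_sort_key\<close> demands that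
        entries with equal label keep their order; this is inherited from the stability of
        \<open>sort\<close> on the indices.\<close>
      have "sort_key (family_label n \<pi>) (map \<pi> r) = map \<pi> (sort r)"
      proof (rule properties_for_sort_key)
        show "mset (map \<pi> (sort r)) = mset (map \<pi> r)" by simp
        have "map (family_label n \<pi>) (map \<pi> (sort r)) = sort r"
          unfolding map_map using r' by (intro map_idI) (simp add: lab subset_iff)
        then show "sorted (map (family_label n \<pi>) (map \<pi> (sort r)))" by simp
        fix k assume "k \<in> set (map \<pi> (sort r))"
        have "map \<pi> (filter (\<lambda>i. i = x) (sort r)) = map \<pi> (filter (\<lambda>i. i = x) r)" for x
        proof -
          have "filter (\<lambda>i. i = x) (sort r) = filter (\<lambda>i. i = x) r"
            using sort_key_stable[of "\<lambda>i. i" x r] by simp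
          then show ?thesis by simp
        qed
        note stable = this
        have filter_lab: "filter (\<lambda>p. family_label n \<pi> k = family_label n \<pi> p) (map \<pi> q) =
            map \<pi> (filter (\<lambda>i. i = family_label n \<pi> k) q)" if q: "set q \<subseteq> {1..n}" for q
          unfolding filter_map
        proof (rule arg_cong[where f = "map \<pi>"], rule filter_cong[OF refl])
          fix i assume "i \<in> set q"
          then have "family_label n \<pi> (\<pi> i) = i" using q by (intro lab) blast
          then show "((\<lambda>p. family_label n \<pi> k = family_label n \<pi> p) \<circ> \<pi>) i = (i = family_label n \<pi> k)"
            by auto
        qed
        have r'': "set (sort r) \<subseteq> {1..n}" using r' by simp
        show "filter (\<lambda>p. family_label n \<pi> k = family_label n \<pi> p) (map \<pi> (sort r)) =
            filter (\<lambda>p. family_label n \<pi> k = family_label n \<pi> p) (map \<pi> r)"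
          unfolding filter_lab[OF r'] filter_lab[OF r''] by (rule stable)
      qed
      moreover have "sort r ! j \<in> {1..n}" "r ! j \<in> {1..n}" if "j < length r" for j
      proof -
        have "r ! j \<in> set r" using that by (rule nth_mem)
        moreover have "sort r ! j \<in> set (sort r)" by (rule nth_mem) (simp add: that)
        ultimately show "sort r ! j \<in> {1..n}" "r ! j \<in> {1..n}" using r' by auto
      qed
      ultimately show ?thesis using family_less_iff[OF inj] by simp
    qed
    then show ?thesis unfolding excedance_free_iff by simp
  qed
  then have "card {U \<in> tableaux lam (\<pi> ` {1..n}). excedance_free (family_less D n s \<pi>) (family_label n \<pi>) U} =
      card {V \<in> tableaux lam {1..n}. \<forall>r\<in>set V. ?Q r}"
    unfolding card_tableaux_image[OF inj] by (metis (no_types, lifting))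
  then show ?thesis
    using card_tableaux_rows[of "{1..n}" lam ?Q] by (simp add: excedance_free_words_def)
qed

lemma immanant_eq:
  assumes "sum_list lam = n"
  shows "immanant n (eta_char lam) A =
    (\<Sum>w | w permutes {1..n}. block_sum lam (\<lambda>I. of_bool (w ` I = I)) {1..n} * (\<Prod>i\<in>{1..n}. A i (w i)))"
proof -
  have "carrier (sym_group n) = {w. w permutes {1..n}}" by (auto simp: sym_group_carrier)
  then show ?thesis
    unfolding immanant_def using eta_char_eq_block_sum[of _ lam] assms by (auto intro!: sum.cong)
qed

text \<open>The product of matrix entries belonging to \<open>w\<close> expands into the families of
  type \<open>w\<close>, which all have the same number of tableaux. The identity therefore holds
  type by type.\<close>

lemma immanant_row_closed:
  assumes "sum_list lam = n"
  shows "immanant n (eta_char lam) (path_matrix D s t wgt) =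
      (\<Sum>\<pi>\<in>path_families D n s t. family_wgt n wgt \<pi> *
         real (card {U \<in> tableaux lam (\<pi> ` {1..n}). row_closed D n s t U \<and> left_row_strict D n s U}))"
  unfolding immanant_eq[OF assms] sum_path_families
proof (rule sum.cong[OF refl])
  fix w assume "w \<in> {w. w permutes {1..n}}"
  then have w: "w permutes {1..n}" by simp
  show "block_sum lam (\<lambda>I. of_bool (w ` I = I)) {1..n} * (\<Prod>i\<in>{1..n}. path_matrix D s t wgt i (w i)) =
      (\<Sum>\<pi>\<in>PiE {1..n} (\<lambda>i. paths i (w i)). family_wgt n wgt \<pi> *
         real (card {U \<in> tableaux lam (\<pi> ` {1..n}). row_closed D n s t U \<and> left_row_strict D n s U}))"
    using card_row_closed_left_strict[OF w, of _ lam]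
    by (simp add: prod_path_matrix sum_distrib_left family_wgt_def mult.commute)
qed

text \<open>Kept in terms of \<open>block_sum\<close> rather than tableaux, since the excedance-free
  formula is also derived from it.\<close>

lemma immanant_descent_free:
  assumes "sum_list lam = n"
  shows "immanant n (eta_char lam) (path_matrix D s t wgt) =
      (\<Sum>\<pi>\<in>path_families_id D n s t. family_wgt n wgt \<pi> *
         block_sum lam (\<lambda>I. real (card (descent_free_words (family_order \<pi>) I))) {1..n})"
proof -
  have "immanant n (eta_char lam) (path_matrix D s t wgt) = block_sum lam (perm_on (path_matrix D s t wgt)) {1..n}"
    unfolding immanant_eq[OF assms] by (rule sum_block_sum_permutes) simp
  also have "\<dots> = block_sum lam (\<lambda>I. \<Sum>\<pi>\<in>PiE I (\<lambda>i. paths i i). (\<Prod>i\<in>I. path_wgt wgt (\<pi> i)) *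
      real (card (descent_free_words (family_order \<pi>) I))) {1..n}"
    by (rule block_sum_cong) (rule perm_on_path_matrix)
  also have "\<dots> = (\<Sum>\<pi>\<in>PiE {1..n} (\<lambda>i. paths i i). (\<Prod>i\<in>{1..n}. path_wgt wgt (\<pi> i)) *
      block_sum lam (\<lambda>I. real (card (descent_free_words (family_order \<pi>) I))) {1..n})"
  proof (rule sum_PiE_block_sum[symmetric])
    fix \<pi> \<pi>' :: "nat \<Rightarrow> 'b list" and I
    assume "\<And>i. i \<in> I \<Longrightarrow> \<pi> i = \<pi>' i"
    then have "descent_free_words (family_order \<pi>) I = descent_free_words (family_order \<pi>') I"
      by (intro descent_free_words_cong family_order_cong) auto
    then show "real (card (descent_free_words (family_order \<pi>) I)) = real (card (descent_free_words (family_order \<pi>') I))"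
      by simp
  qed simp
  finally show ?thesis unfolding path_families_id_eq family_wgt_def .
qed

end

theorem theorem4p15:
  fixes D :: "('a, 'b) pre_digraph"
    and n :: nat
    and s t :: "nat \<Rightarrow> 'a"
    and wgt :: "'b \<Rightarrow> real"
    and lam :: "nat list"
  assumes "planar_network D n s t wgt"
    and "is_partition lam n"
  shows "immanant n (eta_char lam) (path_matrix D s t wgt) =
      (\<Sum>\<pi>\<in>path_families D n s t. family_wgt n wgt \<pi> *
         real (card {U \<in> tableaux lam (\<pi> ` {1..n}). row_closed D n s t U \<and> left_row_strict D n s U})) \<and>
    immanant n (eta_char lam) (path_matrix D s t wgt) =
      (\<Sum>\<pi>\<in>path_families_id D n s t. family_wgt n wgt \<pi> *
         real (card {U \<in> tableaux lam (\<pi> ` {1..n}). descent_free (family_less D n s \<pi>) U})) \<and>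
    immanant n (eta_char lam) (path_matrix D s t wgt) =
      (\<Sum>\<pi>\<in>path_families_id D n s t. family_wgt n wgt \<pi> *
         real (card {U \<in> tableaux lam (\<pi> ` {1..n}).
           excedance_free (family_less D n s \<pi>) (family_label n \<pi>) U}))"
proof -
  interpret planar_network D n s t wgt by fact
  have lam: "sum_list lam = n" using assms(2) by (simp add: is_partition_def)
  have inj: "inj_on \<pi> {1..n}" if "\<pi> \<in> path_families_id D n s t" for \<pi>
    using that family_inj[of id \<pi>] by (simp add: path_families_id_eq permutes_id)
  \<comment> \<open>The two counts agree for each family and each block, so no cancellation between
    families is involved.\<close>
  have exc: "block_sum lam (\<lambda>I. real (card (excedance_free_words (family_order \<pi>) I))) {1..n} =
      block_sum lam (\<lambda>I. real (card (descent_free_words (family_order \<pi>) I))) {1..n}"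
    if \<pi>: "\<pi> \<in> path_families_id D n s t" for \<pi>
  proof (rule block_sum_cong)
    fix I assume I: "I \<subseteq> {1..n}"
    have "finite I" using I by (rule finite_subset) simp
    moreover have "family_order \<pi> x z" if "x \<in> I" "y \<in> I" "z \<in> I" "family_order \<pi> x y" "family_order \<pi> y z" for x y z
      using \<pi> that I unfolding path_families_id_eq by (intro family_order_trans_id[of \<pi> "{1..n}" x y z]) auto
    ultimately have "card (excedance_free_words (family_order \<pi>) I) = card (descent_free_words (family_order \<pi>) I)"
      by (intro card_excedance_free_eq_descent_free family_order_less) blast+
    then show "real (card (excedance_free_words (family_order \<pi>) I)) = real (card (descent_free_words (family_order \<pi>) I))"
      by simp
  qed
  have des: "(\<Sum>\<pi>\<in>path_families_id D n s t. family_wgt n wgt \<pi> *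
         real (card {U \<in> tableaux lam (\<pi> ` {1..n}). descent_free (family_less D n s \<pi>) U})) =
      immanant n (eta_char lam) (path_matrix D s t wgt)"
    unfolding immanant_descent_free[OF lam]
    by (rule sum.cong[OF refl]) (simp only: card_descent_free[OF inj])
  have "(\<Sum>\<pi>\<in>path_families_id D n s t. family_wgt n wgt \<pi> *
         real (card {U \<in> tableaux lam (\<pi> ` {1..n}).
           excedance_free (family_less D n s \<pi>) (family_label n \<pi>) U})) =
      immanant n (eta_char lam) (path_matrix D s t wgt)"
    unfolding immanant_descent_free[OF lam]
    by (rule sum.cong[OF refl]) (simp only: card_excedance_free[OF inj] exc)
  with des show ?thesis
    using immanant_row_closed[OF lam] by (intro conjI) (simp_all only:)
qed

end
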